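(* Computing a polylogarithmic-factor approximation of minimum dominating set is $\mathsf{P}$-$\mathsf{SLOCAL}$-complete.
   Context: Given a graph $G=(V,E)$ (which is also the communication network, $n=|V|$), a dominating set is $D\subseteq V$ such that each $u\in V$ is in $D$ or has a neighbor in $D$; an $\alpha$-approximation is a dominating set of size at most $\alpha$ times the minimum, and here $\alpha=\mathrm{polylog}\, n$. $\mathsf{P}$-$\mathsf{SLOCAL}$ is the class of problems solvable by a deterministic SLOCAL algorithm with locality $\mathrm{polylog}\, n$ (nodes processed sequentially in an arbitrary order, each reading its $\mathrm{polylog}\, n$-hop neighborhood including information stored by previously processed nodes). A problem $\mathcal A$ is $\mathsf{P}$-$\mathsf{SLOCAL}$-complete if $\mathcal A\in\mathsf{P}$-$\mathsf{SLOCAL}$ and, if $\mathcal A$ had a deterministic LOCAL algorithm with $\mathrm{polylog}\, n$ rounds, then every problem in $\mathsf{P}$-$\mathsf{SLOCAL}$ would have one. *)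

theory Defs
  imports Complex_Main "HOL-Library.Landau_Symbols" "Graph_Theory.Pair_Digraph"
begin

definition polylog :: "(nat \<Rightarrow> real) \<Rightarrow> bool" where
  "polylog f \<longleftrightarrow> (\<exists>k. f \<in> O(\<lambda>n. ln (real n) ^ k))"


text \<open>
  The nodes of a communication network are natural numbers, and the name of a node is its unique
  identifier. Statements quantify over all networks, hence over all assignments of identifiers.
  The bound below says that identifiers have O(log n) bits; the constant c is arbitrary but fixed
  (the 1 added to n only avoids a degenerate bound on very small networks).
\<close>

type_synonym network = "nat pair_pre_digraph"

definition network :: "nat \<Rightarrow> network \<Rightarrow> bool" where
  "network c G \<longleftrightarrow> pair_graph G \<and> (\<forall>v\<in>pverts G. v < (card (pverts G) + 1) ^ c)"

definition nbrs :: "network \<Rightarrow> nat \<Rightarrow> nat set" where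
  "nbrs G v = {u. (v, u) \<in> parcs G}"

definition hop_ball :: "network \<Rightarrow> nat \<Rightarrow> nat \<Rightarrow> nat set" where
  "hop_ball G r v = {u \<in> pverts G. \<exists>k\<le>r. (v, u) \<in> parcs G ^^ k}"

definition induced :: "network \<Rightarrow> nat set \<Rightarrow> network" where
  "induced G B = \<lparr> pverts = pverts G \<inter> B, parcs = parcs G \<inter> B \<times> B \<rparr>"


text \<open>
  A distributed graph problem relates a network, the inputs of its nodes and the outputs of its
  nodes (both maps whose domain is the set of nodes); a promise on the instances can be expressed by
  a relation that holds trivially outside the promise. Since the names of the nodes are visible,
  outputs may refer to neighbours (as in matching or edge colouring). Inputs, outputs, messages and
  memory contents are finite objects, encoded as natural numbers without any bound on their size.
\<close>

type_synonym labelling = "nat \<rightharpoonup> nat"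
type_synonym dist_problem = "network \<Rightarrow> labelling \<Rightarrow> labelling \<Rightarrow> bool"


text \<open>
  Deterministic LOCAL model: synchronous message passing with unbounded messages and unbounded
  local computation (so the components of an algorithm are arbitrary functions). A node is
  initialised with n, its identifier, the identifiers of its neighbours and its input. In each round
  it sends a message to every neighbour (the second argument of \<open>l_msg\<close> is the receiver)
  and updates its state from the messages received, indexed by their senders.
\<close>

record local_alg =
  l_init :: "nat \<Rightarrow> nat \<Rightarrow> nat set \<Rightarrow> nat \<Rightarrow> nat"
  l_msg :: "nat \<Rightarrow> nat \<Rightarrow> nat"
  l_step :: "nat \<Rightarrow> (nat \<rightharpoonup> nat) \<Rightarrow> nat"
  l_out :: "nat \<Rightarrow> nat"

primrec local_state :: "local_alg \<Rightarrow> network \<Rightarrow> labelling \<Rightarrow> nat \<Rightarrow> nat \<Rightarrow> nat" where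
  "local_state A G x 0 v = l_init A (card (pverts G)) v (nbrs G v) (the (x v))"
| "local_state A G x (Suc t) v =
     l_step A (local_state A G x t v)
       (\<lambda>u. if u \<in> nbrs G v then Some (l_msg A (local_state A G x t u) v) else None)"

definition local_output :: "local_alg \<Rightarrow> nat \<Rightarrow> network \<Rightarrow> labelling \<Rightarrow> labelling" where
  "local_output A T G x =
     (\<lambda>v. if v \<in> pverts G then Some (l_out A (local_state A G x T v)) else None)"

definition local_solves :: "nat \<Rightarrow> local_alg \<Rightarrow> (nat \<Rightarrow> nat) \<Rightarrow> dist_problem \<Rightarrow> bool" where
  "local_solves c A T P \<longleftrightarrow>
     (\<forall>G x. network c G \<longrightarrow> dom x = pverts G \<longrightarrow>
        P G x (local_output A (T (card (pverts G))) G x))"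

definition P_LOCAL :: "dist_problem set" where
  "P_LOCAL = {P. \<forall>c. \<exists>A T. polylog (\<lambda>n. real (T n)) \<and> local_solves c A T P}"


text \<open>
  Deterministic SLOCAL model: when a node is processed, it sees the subgraph induced by its r-hop
  neighbourhood, with identifiers, inputs, and the memory contents written by the nodes processed
  earlier (\<open>None\<close> for a node that is not yet processed). It then writes its own
  memory, which determines its output.
\<close>

record slocal_view =
  sv_size :: nat
  sv_center :: nat
  sv_graph :: network
  sv_input :: labelling
  sv_memory :: labelling

record slocal_alg =
  s_process :: "slocal_view \<Rightarrow> nat"
  s_out :: "nat \<Rightarrow> nat"

definition slocal_view_of ::
    "nat \<Rightarrow> network \<Rightarrow> labelling \<Rightarrow> labelling \<Rightarrow> nat \<Rightarrow> slocal_view" where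
  "slocal_view_of r G x M v =
     \<lparr> sv_size = card (pverts G), sv_center = v,
       sv_graph = induced G (hop_ball G r v),
       sv_input = x |` hop_ball G r v,
       sv_memory = M |` hop_ball G r v \<rparr>"

definition slocal_output ::
    "slocal_alg \<Rightarrow> nat \<Rightarrow> network \<Rightarrow> labelling \<Rightarrow> nat list \<Rightarrow> labelling" where
  "slocal_output A r G x vs =
     map_option (s_out A) \<circ>
       foldl (\<lambda>M v. M(v \<mapsto> s_process A (slocal_view_of r G x M v))) Map.empty vs"

definition slocal_solves :: "nat \<Rightarrow> slocal_alg \<Rightarrow> (nat \<Rightarrow> nat) \<Rightarrow> dist_problem \<Rightarrow> bool" where
  "slocal_solves c A r P \<longleftrightarrow>
     (\<forall>G x vs. network c G \<longrightarrow> dom x = pverts G \<longrightarrow> distinct vs \<longrightarrow> set vs = pverts G \<longrightarrow>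
        P G x (slocal_output A (r (card (pverts G))) G x vs))"

definition P_SLOCAL :: "dist_problem set" where
  "P_SLOCAL = {P. \<forall>c. \<exists>A r. polylog (\<lambda>n. real (r n)) \<and> slocal_solves c A r P}"


definition P_SLOCAL_hard :: "dist_problem \<Rightarrow> bool" where
  "P_SLOCAL_hard P \<longleftrightarrow> (P \<in> P_LOCAL \<longrightarrow> P_SLOCAL \<subseteq> P_LOCAL)"

definition P_SLOCAL_complete :: "dist_problem \<Rightarrow> bool" where
  "P_SLOCAL_complete P \<longleftrightarrow> P \<in> P_SLOCAL \<and> P_SLOCAL_hard P"


definition dominating_set :: "network \<Rightarrow> nat set \<Rightarrow> bool" where
  "dominating_set G D \<longleftrightarrow>
     D \<subseteq> pverts G \<and> (\<forall>u\<in>pverts G. u \<in> D \<or> (\<exists>w\<in>D. (u, w) \<in> parcs G))"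

definition domination_number :: "network \<Rightarrow> nat" where
  "domination_number G = (LEAST k. \<exists>D. dominating_set G D \<and> card D = k)"

text \<open>
  No inputs are used; the computed set consists of the nodes that output 1. The factor may depend
  on the number of nodes.
\<close>

definition mds_approx :: "(nat \<Rightarrow> real) \<Rightarrow> dist_problem" where
  "mds_approx \<alpha> G x y \<longleftrightarrow>
     (let D = {v. y v = Some 1} in
        dominating_set G D \<and>
        real (card D) \<le> \<alpha> (card (pverts G)) * real (domination_number G))"

end

theory Submission
  imports Defs "HOL-Library.Product_Lexorder"
begin

text \<open>
  Hardness holds because \<open>P_SLOCAL \<subseteq> P_LOCAL\<close> outright, by the deterministic network
  decomposition of Rozhon and Ghaffari. On the r-th power of the network, every node starts as its
  own cluster, labelled by its identifier. In phase i, nodes whose label has i-th bit 0 (blue) that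
  are adjacent to clusters whose label has i-th bit 1 (red) ask to join one of them. A red cluster
  accepts if it grows by a factor of at least 1 + 1/B, where B is twice the number of bits, and
  otherwise kills all askers and has no blue neighbour from then on. After O(B log n) steps no red
  node is adjacent to a blue one, at most a 1/B fraction of the nodes has died, and after all phases
  adjacent survivors have equal labels. The survivors form one colour class; recursing on the dead
  nodes gives O(log n) colours. Every node stays close to the node that its label names, so all
  steps are local. An SLOCAL algorithm with locality r is then run colour by colour: the clusters of
  one colour are too far apart to influence each other.

  For membership, a processed node v grows a ball around itself in the set U of nodes that are not
  yet covered, until two more hops increase the domination number of the part of U inside the ball by
  at most a factor 1 + \<epsilon>. It then covers the outer ball optimally and removes it from U. The
  inner balls have disjoint closed neighbourhoods, hence their domination numbers add up to a lower
  bound for the optimum. The radius starts at 1, so that all neighbours of v leave U and no later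
  choice can change the output of v.
\<close>

section \<open>Balls\<close>

lemma network_facts:
  assumes "network c G"
  shows "finite (pverts G)" "(u, v) \<in> parcs G \<Longrightarrow> u \<in> pverts G"
    "(u, v) \<in> parcs G \<Longrightarrow> v \<in> pverts G" "(u, v) \<in> parcs G \<Longrightarrow> (v, u) \<in> parcs G"
    "v \<in> pverts G \<Longrightarrow> v < (card (pverts G) + 1) ^ c"
proof -
  interpret pair_graph G
    using assms by (simp add: network_def)
  show "finite (pverts G)"
    by (rule pair_finite_verts)
  show "(u, v) \<in> parcs G \<Longrightarrow> u \<in> pverts G" "(u, v) \<in> parcs G \<Longrightarrow> v \<in> pverts G"
    by (auto dest: in_arcsD1 in_arcsD2)
  show "(u, v) \<in> parcs G \<Longrightarrow> (v, u) \<in> parcs G"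
    using pair_sym_arcs by (auto simp: symmetric_def sym_def)
  show "v \<in> pverts G \<Longrightarrow> v < (card (pverts G) + 1) ^ c"
    using assms by (simp add: network_def)
qed

lemma hop_ball_subset: "hop_ball G r v \<subseteq> pverts G"
  by (auto simp: hop_ball_def)

lemma finite_hop_ball [simp]: "network c G \<Longrightarrow> finite (hop_ball G r v)"
  using hop_ball_subset network_facts(1) by (rule finite_subset)

lemma finite_nbrs [simp]: "network c G \<Longrightarrow> finite (nbrs G v)"
  by (rule finite_subset[of _ "pverts G"]) (auto simp: nbrs_def network_facts)

lemma nbrs_subset: "network c G \<Longrightarrow> nbrs G v \<subseteq> pverts G"
  by (auto simp: nbrs_def network_facts)

lemma hop_ball_0: "v \<in> pverts G \<Longrightarrow> hop_ball G 0 v = {v}"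
  by (auto simp: hop_ball_def)

lemma hop_ball_center [simp]: "v \<in> pverts G \<Longrightarrow> v \<in> hop_ball G r v"
  by (auto simp: hop_ball_def intro!: exI[of _ 0])

lemma hop_ball_mono: "r \<le> s \<Longrightarrow> hop_ball G r v \<subseteq> hop_ball G s v"
  unfolding hop_ball_def using order_trans by blast

lemma hop_ball_add:
  assumes "u \<in> hop_ball G r v" "w \<in> hop_ball G s u"
  shows "w \<in> hop_ball G (r + s) v"
proof -
  obtain i j where "i \<le> r" "(v, u) \<in> parcs G ^^ i" "j \<le> s" "(u, w) \<in> parcs G ^^ j"
    using assms by (auto simp: hop_ball_def)
  moreover have "w \<in> pverts G"
    using assms by (auto simp: hop_ball_def)
  ultimately show ?thesis
    by (auto simp: hop_ball_def relpow_add intro!: exI[of _ "i + j"])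
qed

text \<open>\<open>hop_ball\<close> restricts only its members to the vertex set. The centre is a
  vertex too, since a path is either empty or starts with an arc. This later shows that labels are
  identifiers and hence short.\<close>

lemma hop_ball_center_verts:
  assumes "network c G" "u \<in> hop_ball G r v"
  shows "v \<in> pverts G"
proof -
  obtain k where k: "(v, u) \<in> parcs G ^^ k" and "u \<in> pverts G"
    using assms(2) by (auto simp: hop_ball_def)
  show ?thesis
  proof (cases k)
    case (Suc m)
    then show ?thesis
      using k network_facts(2)[OF assms(1)] relpow_Suc_D2[of v u m] by blast
  qed (use k \<open>u \<in> pverts G\<close> in simp)
qed

lemma hop_ball_sym:
  assumes "network c G" "u \<in> hop_ball G r v"
  shows "v \<in> hop_ball G r u"
proof -
  have "(a, b) \<in> parcs G ^^ k \<longleftrightarrow> (b, a) \<in> parcs G ^^ k" for a b k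
  proof (induction k arbitrary: a b)
    case (Suc k)
    have "(a, b) \<in> parcs G ^^ Suc k \<longleftrightarrow> (\<exists>c. (a, c) \<in> parcs G ^^ k \<and> (c, b) \<in> parcs G)"
      by auto
    also have "\<dots> \<longleftrightarrow> (\<exists>c. (b, c) \<in> parcs G \<and> (c, a) \<in> parcs G ^^ k)"
      using Suc.IH network_facts(4)[OF assms(1)] by blast
    also have "\<dots> \<longleftrightarrow> (b, a) \<in> parcs G ^^ Suc k"
      using relpow_Suc_D2 relpow_Suc_I2 by metis
    finally show ?case .
  qed auto
  then show ?thesis
    using assms hop_ball_center_verts[OF assms] by (auto simp: hop_ball_def)
qed

lemma nbrs_hop_ball: "network c G \<Longrightarrow> u \<in> nbrs G v \<Longrightarrow> u \<in> hop_ball G 1 v"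
  by (auto simp: nbrs_def hop_ball_def network_facts intro!: exI[of _ 1])

lemma hop_ball_Suc:
  assumes "network c G" "v \<in> pverts G"
  shows "hop_ball G (Suc r) v = hop_ball G r v \<union> (\<Union>u\<in>hop_ball G r v. nbrs G u)"
    (is "_ = ?R")
proof
  show "?R \<subseteq> hop_ball G (Suc r) v"
    using hop_ball_mono[of r "Suc r" G v] hop_ball_add[of _ G r v _ 1] nbrs_hop_ball[OF assms(1)]
    by fastforce
  show "hop_ball G (Suc r) v \<subseteq> ?R"
  proof
    fix u assume "u \<in> hop_ball G (Suc r) v"
    then obtain k where k: "k \<le> Suc r" "(v, u) \<in> parcs G ^^ k" "u \<in> pverts G"
      by (auto simp: hop_ball_def)
    show "u \<in> ?R"
    proof (cases "k \<le> r")
      case False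
      then obtain w where "(v, w) \<in> parcs G ^^ r" "(w, u) \<in> parcs G"
        using k by (auto simp: le_Suc_eq)
      then have "w \<in> hop_ball G r v" "u \<in> nbrs G w"
        using network_facts(2)[OF assms(1)] by (auto simp: hop_ball_def nbrs_def)
      then show ?thesis by blast
    qed (use k in \<open>auto simp: hop_ball_def\<close>)
  qed
qed

text \<open>Splitting off the first arc instead of the last one matches a round of flooding, in
  which neighbours pass on the balls around themselves.\<close>

lemma hop_ball_Suc':
  assumes "network c G" "v \<in> pverts G"
  shows "hop_ball G (Suc r) v = hop_ball G r v \<union> (\<Union>u\<in>nbrs G v. hop_ball G r u)"
    (is "_ = ?R")
proof
  show "?R \<subseteq> hop_ball G (Suc r) v"
    using hop_ball_mono[of r "Suc r" G v] hop_ball_add[of _ G 1 v _ r] nbrs_hop_ball[OF assms(1)]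
    by fastforce
  show "hop_ball G (Suc r) v \<subseteq> ?R"
  proof
    fix u assume "u \<in> hop_ball G (Suc r) v"
    then obtain k where k: "k \<le> Suc r" "(v, u) \<in> parcs G ^^ k" "u \<in> pverts G"
      by (auto simp: hop_ball_def)
    show "u \<in> ?R"
    proof (cases "k \<le> r")
      case False
      then have "k = Suc r" using k by simp
      then obtain w where "(v, w) \<in> parcs G" "(w, u) \<in> parcs G ^^ r"
        using k(2) relpow_Suc_D2 by metis
      then show ?thesis
        using k by (auto simp: hop_ball_def nbrs_def)
    qed (use k in \<open>auto simp: hop_ball_def\<close>)
  qed
qed

text \<open>Inspecting the ball in \<open>G\<close> suffices: grown hop by hop from the same centre,
  both balls are extended through the same neighbourhoods.\<close>

lemma hop_ball_cong:
  assumes "network c G" "network c' G'" "v \<in> pverts G" "v \<in> pverts G'"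
    and "\<And>u. u \<in> hop_ball G r v \<Longrightarrow> nbrs G u = nbrs G' u"
  shows "hop_ball G r v = hop_ball G' r v"
  using assms(5)
proof (induction r)
  case 0
  then show ?case using assms by (simp add: hop_ball_0)
next
  case (Suc r)
  have "hop_ball G r v \<subseteq> hop_ball G (Suc r) v"
    by (rule hop_ball_mono) simp
  with Suc show ?case
    using assms(1-4) by (auto simp: hop_ball_Suc)
qed


section \<open>Views in the LOCAL model\<close>

text \<open>Neighbourhoods of nodes at distance exactly \<open>r\<close> are included, because a
  node knows its neighbours before the first round. The number of nodes is compared
  separately.\<close>

definition same_view :: "nat \<Rightarrow> network \<Rightarrow> labelling \<Rightarrow> network \<Rightarrow> labelling \<Rightarrow> nat \<Rightarrow> bool" where
  "same_view r G x G' x' v \<longleftrightarrow> v \<in> pverts G \<and> v \<in> pverts G' \<and> hop_ball G r v = hop_ball G' r v \<and>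
     (\<forall>u\<in>hop_ball G r v. nbrs G u = nbrs G' u \<and> x u = x' u)"

text \<open>By the triangle inequality the \<open>r\<close>-ball around \<open>u\<close> lies in the
  \<open>(r + s)\<close>-ball around \<open>v\<close>. All later locality bounds rest on this:
  consulting nodes \<open>s\<close> hops away adds \<open>s\<close> to the locality.\<close>

lemma same_view_sub:
  assumes "network c G" "network c' G'" "same_view (r + s) G x G' x' v" "u \<in> hop_ball G s v"
  shows "same_view r G x G' x' u"
proof -
  have *: "w \<in> hop_ball G (r + s) v" if "w \<in> hop_ball G r u" for w
    using hop_ball_add[OF assms(4) that] by (simp add: add.commute)
  have "hop_ball G s v \<subseteq> hop_ball G (r + s) v"
    by (rule hop_ball_mono) simp
  then have "u \<in> pverts G" "u \<in> pverts G'"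
    using assms(3,4) hop_ball_subset unfolding same_view_def by blast+
  moreover have "hop_ball G r u = hop_ball G' r u"
    using calculation assms * by (intro hop_ball_cong[OF assms(1,2)]) (auto simp: same_view_def)
  ultimately show ?thesis
    using assms * by (auto simp: same_view_def)
qed

lemma same_view_mono:
  assumes "network c G" "network c' G'" "same_view s G x G' x' v" "r \<le> s"
  shows "same_view r G x G' x' v"
proof (rule same_view_sub[OF assms(1,2)])
  show "same_view (r + (s - r)) G x G' x' v"
    using assms by simp
  show "v \<in> hop_ball G (s - r) v"
    using assms(3) by (simp add: same_view_def)
qed

definition view_code :: "nat \<Rightarrow> network \<Rightarrow> labelling \<Rightarrow> nat \<Rightarrow> nat set" where
  "view_code r G x v =
     (\<lambda>u. prod_encode (u, prod_encode (set_encode (nbrs G u), the (x u)))) ` hop_ball G r v"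

text \<open>Each node forwards all it knows and merges what it receives; \<open>f\<close> turns the
  final knowledge into an output. The state consists of the number of nodes, the own identifier and
  the code of the known view.\<close>

definition flood :: "(nat \<Rightarrow> nat) \<Rightarrow> local_alg" where
  "flood f =
     \<lparr> l_init = (\<lambda>n v N i. prod_encode (n, prod_encode (v,
         set_encode {prod_encode (v, prod_encode (set_encode N, i))}))),
       l_msg = (\<lambda>s _. s),
       l_step = (\<lambda>s m. case prod_decode s of (n, s') \<Rightarrow> case prod_decode s' of (v, K) \<Rightarrow>
         prod_encode (n, prod_encode (v, set_encode (set_decode K \<union>
           (\<Union>u\<in>dom m. set_decode (snd (prod_decode (snd (prod_decode (the (m u))))))))))),
       l_out = f \<rparr>"

lemma local_state_flood:
  assumes "network c G" "v \<in> pverts G"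
  shows "local_state (flood f) G x t v =
    prod_encode (card (pverts G), prod_encode (v, set_encode (view_code t G x v)))"
  using assms(2)
proof (induction t arbitrary: v)
  case 0
  then show ?case
    by (simp add: flood_def view_code_def hop_ball_0)
next
  case (Suc t)
  have fin: "finite (view_code t G x u)" for u
    using assms(1) by (simp add: view_code_def)
  have nb: "u \<in> pverts G" if "u \<in> nbrs G v" for u
    using nbrs_subset[OF assms(1)] that by blast
  define m where "m = (\<lambda>u. if u \<in> nbrs G v then Some (local_state (flood f) G x t u) else None)"
  have dom_m: "dom m = nbrs G v"
    by (auto simp: m_def split: if_splits)
  have m: "set_decode (snd (prod_decode (snd (prod_decode (the (m u)))))) = view_code t G x u"
    if "u \<in> nbrs G v" for u
    using that nb fin Suc.IH by (simp add: m_def)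
  have msg: "l_msg (flood f) s w = s" for s w
    by (simp add: flood_def)
  have "local_state (flood f) G x (Suc t) v = l_step (flood f) (local_state (flood f) G x t v) m"
    by (simp add: msg m_def cong: if_cong)
  also have "\<dots> = prod_encode (card (pverts G), prod_encode (v,
      set_encode (view_code t G x v \<union> (\<Union>u\<in>dom m. set_decode (snd (prod_decode (snd (prod_decode (the (m u))))))))))"
    unfolding Suc.IH[OF Suc.prems] by (simp add: flood_def fin)
  also have "(\<Union>u\<in>dom m. set_decode (snd (prod_decode (snd (prod_decode (the (m u))))))) =
      (\<Union>u\<in>nbrs G v. view_code t G x u)"
    unfolding dom_m using m by (rule SUP_cong[OF refl])
  also have "view_code t G x v \<union> (\<Union>u\<in>nbrs G v. view_code t G x u) = view_code (Suc t) G x v"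
    by (auto simp: view_code_def hop_ball_Suc'[OF assms(1) Suc.prems])
  finally show ?case .
qed

text \<open>Each entry of the code carries its node as first component, so the ball and the data of
  its nodes can be recovered. Inputs are stored through \<open>the\<close>, hence the assumptions on
  the domains.\<close>

lemma same_view_if_view_code_eq:
  assumes "network c G" "network c' G'" "dom x = pverts G" "dom x' = pverts G'"
    "v \<in> pverts G" "v \<in> pverts G'" "view_code r G x v = view_code r G' x' v"
  shows "same_view r G x G' x' v"
proof -
  let ?h = "\<lambda>G x u. prod_encode (u, prod_encode (set_encode (nbrs G u), the (x u)))"
  have ball: "hop_ball G r v = (fst \<circ> prod_decode) ` view_code r G x v" for G and x :: labelling
    by (auto simp: view_code_def image_comp)
  then have *: "hop_ball G r v = hop_ball G' r v"
    using assms(7) by metis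
  have "nbrs G u = nbrs G' u \<and> x u = x' u" if u: "u \<in> hop_ball G r v" for u
  proof -
    have "?h G x u \<in> view_code r G' x' v"
      using u assms(7) by (auto simp: view_code_def)
    then have "set_encode (nbrs G u) = set_encode (nbrs G' u)" "the (x u) = the (x' u)"
      by (auto simp: view_code_def)
    moreover have "u \<in> dom x" "u \<in> dom x'"
      using u * assms(3,4) hop_ball_subset by blast+
    ultimately show ?thesis
      using assms(1,2) by (auto simp: set_encode_eq)
  qed
  then show ?thesis
    using * assms by (simp add: same_view_def)
qed

text \<open>Local computation is unrestricted, so no procedure for \<open>F\<close> is needed:
  flooding computes every function whose value is determined by the number of nodes and the
  view.\<close>

lemma local_alg_exists:
  assumes F: "\<And>G G' x x' v. network c G \<Longrightarrow> network c G' \<Longrightarrow> card (pverts G) = card (pverts G') \<Longrightarrow>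
    dom x = pverts G \<Longrightarrow> dom x' = pverts G' \<Longrightarrow> same_view (T (card (pverts G))) G x G' x' v \<Longrightarrow>
    F G x v = F G' x' v"
  shows "\<exists>A. \<forall>G x. network c G \<longrightarrow> dom x = pverts G \<longrightarrow>
    local_output A (T (card (pverts G))) G x = (\<lambda>v. if v \<in> pverts G then Some (F G x v) else None)"
proof -
  define code where "code = (\<lambda>G x v. prod_encode (card (pverts G),
    prod_encode (v, set_encode (view_code (T (card (pverts G))) G x v))))"
  \<comment> \<open>The output function will pick some value that a network with code
    \<open>s\<close> yields; by locality of \<open>F\<close> all such networks yield the same
    one.\<close>
  define P where "P = (\<lambda>s y. \<exists>G x v. network c G \<and> dom x = pverts G \<and> v \<in> pverts G \<and>
    code G x v = s \<and> y = F G x v)"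
  have out: "(SOME y. P (code G x v) y) = F G x v"
    if "network c G" "dom x = pverts G" "v \<in> pverts G" for G x v
  proof -
    have "P (code G x v) (F G x v)"
      using that by (auto simp: P_def)
    then have "P (code G x v) (SOME y. P (code G x v) y)"
      by (rule someI)
    then obtain G' x' v' where G': "network c G'" "dom x' = pverts G'" "v' \<in> pverts G'"
      "code G' x' v' = code G x v" "(SOME y. P (code G x v) y) = F G' x' v'"
      by (auto simp: P_def)
    have fin: "finite (view_code r G x v)" if "network c G" for r G x v
      using that by (simp add: view_code_def)
    have "card (pverts G') = card (pverts G)" "v' = v"
      "view_code (T (card (pverts G))) G' x' v = view_code (T (card (pverts G))) G x v"
      using G' that fin by (auto simp: code_def set_encode_eq)
    then have "F G' x' v = F G x v"
      using that G' by (intro F same_view_if_view_code_eq[of c _ c]) auto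
    then show ?thesis using G' \<open>v' = v\<close> by simp
  qed
  have "local_output (flood (\<lambda>s. SOME y. P s y)) (T (card (pverts G))) G x =
      (\<lambda>v. if v \<in> pverts G then Some (F G x v) else None)"
    if "network c G" "dom x = pverts G" for G x
  proof
    fix v
    show "local_output (flood (\<lambda>s. SOME y. P s y)) (T (card (pverts G))) G x v =
        (if v \<in> pverts G then Some (F G x v) else None)"
    proof (cases "v \<in> pverts G")
      case True
      then have "local_state (flood (\<lambda>s. SOME y. P s y)) G x (T (card (pverts G))) v = code G x v"
        using local_state_flood[OF that(1) True] by (simp add: code_def)
      moreover have "l_out (flood (\<lambda>s. SOME y. P s y)) = (\<lambda>s. SOME y. P s y)"
        by (simp add: flood_def)
      ultimately show ?thesis
        using out[OF that True] True by (simp add: local_output_def)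
    qed (simp add: local_output_def)
  qed
  then show ?thesis by blast
qed


section \<open>Polylogarithmic functions\<close>

lemma polylog_const: "polylog (\<lambda>_. c)"
  unfolding polylog_def by (rule exI[of _ 0]) simp

lemma polylog_mult:
  assumes "polylog f" "polylog g"
  shows "polylog (\<lambda>n. f n * g n)"
proof -
  obtain j k where "f \<in> O(\<lambda>n. ln (real n) ^ j)" "g \<in> O(\<lambda>n. ln (real n) ^ k)"
    using assms by (auto simp: polylog_def)
  then have "(\<lambda>n. f n * g n) \<in> O(\<lambda>n. ln (real n) ^ (j + k))"
    unfolding power_add by (rule landau_o.big.mult)
  then show ?thesis by (auto simp: polylog_def)
qed

lemma polylog_weaken:
  assumes "f \<in> O(\<lambda>n. ln (real n) ^ j)" "j \<le> k"
  shows "f \<in> O(\<lambda>n. ln (real n) ^ k)"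
proof -
  have "eventually (\<lambda>n. norm (ln (real n) ^ j) \<le> 1 * norm (ln (real n) ^ k)) sequentially"
  \<comment> \<open>From 3 on, \<open>n\<close> exceeds Euler's number, so the logarithm is at least
    1 and its powers increase with the exponent.\<close>
  proof (rule eventually_sequentiallyI[of 3])
    fix n :: nat assume "3 \<le> n"
    then have "exp 1 \<le> real n"
      using exp_le by linarith
    then have "1 \<le> ln (real n)"
      using \<open>3 \<le> n\<close> by (subst ln_ge_iff) auto
    then show "norm (ln (real n) ^ j) \<le> 1 * norm (ln (real n) ^ k)"
      using assms(2) by (simp add: power_increasing)
  qed
  then have "(\<lambda>n. ln (real n) ^ j) \<in> O(\<lambda>n. ln (real n) ^ k)"
    by (rule bigoI)
  with assms(1) show ?thesis
    by (rule landau_o.big_trans)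
qed

lemma polylog_add:
  assumes "polylog f" "polylog g"
  shows "polylog (\<lambda>n. f n + g n)"
proof -
  obtain j k where "f \<in> O(\<lambda>n. ln (real n) ^ j)" "g \<in> O(\<lambda>n. ln (real n) ^ k)"
    using assms by (auto simp: polylog_def)
  then have "(\<lambda>n. f n + g n) \<in> O(\<lambda>n. ln (real n) ^ max j k)"
    by (intro sum_in_bigo) (auto elim: polylog_weaken)
  then show ?thesis by (auto simp: polylog_def)
qed

text \<open>The number of binary digits of \<open>n\<close>; adding 1 inside the logarithm makes the
  bound \<open>n < 2 ^ lg n\<close> strict.\<close>

definition lg :: "nat \<Rightarrow> nat" where
  "lg n = nat \<lceil>log 2 (real (n + 1))\<rceil>"

lemma less_two_power_lg: "n < 2 ^ lg n"
proof -
  have "log 2 (real (n + 1)) \<le> real (lg n)"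
    unfolding lg_def by linarith
  then have "real (n + 1) \<le> 2 powr real (lg n)"
    by (subst (asm) log_le_iff) auto
  also have "\<dots> = real (2 ^ lg n)"
    by (simp add: powr_realpow)
  finally show ?thesis
    by linarith
qed

lemma polylog_lg: "polylog (\<lambda>n. real (lg n))"
proof -
  \<comment> \<open>In the constant, \<open>2 / ln 2\<close> comes from
    \<open>n + 1 \<le> n ^ 2\<close>, and the summand 1 pays for the ceiling.\<close>
  have "eventually (\<lambda>n. norm (real (lg n)) \<le> (2 / ln 2 + 1) * norm (ln (real n) ^ 1)) sequentially"
  proof (rule eventually_sequentiallyI[of 3])
    fix n :: nat assume n: "3 \<le> n"
    then have "exp 1 \<le> real n"
      using exp_le by linarith
    then have 1: "1 \<le> ln (real n)"
      using n by (subst ln_ge_iff) auto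
    have "0 \<le> log 2 (real (n + 1))"
      by simp
    then have "real (lg n) \<le> log 2 (real (n + 1)) + 1"
      unfolding lg_def by linarith
    moreover have "ln (real (n + 1)) \<le> ln (real n ^ 2)"
    proof (subst ln_le_cancel_iff)
      have "n + 1 \<le> n * n"
        using n mult_le_mono1[of 3 n n] by linarith
      then show "real (n + 1) \<le> (real n)\<^sup>2"
        by (simp only: power2_eq_square of_nat_le_iff flip: of_nat_mult)
    qed (use n in auto)
    then have "log 2 (real (n + 1)) \<le> 2 / ln 2 * ln (real n)"
      using n by (simp add: log_def ln_realpow divide_right_mono)
    ultimately have "real (lg n) \<le> 2 / ln 2 * ln (real n) + ln (real n)"
      using 1 by linarith
    then show "norm (real (lg n)) \<le> (2 / ln 2 + 1) * norm (ln (real n) ^ 1)"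
      using 1 by (simp add: algebra_simps)
  qed
  then have "(\<lambda>n. real (lg n)) \<in> O(\<lambda>n. ln (real n) ^ 1)"
    by (rule bigoI)
  then show ?thesis unfolding polylog_def by blast
qed

lemmas polylog_intros = polylog_const polylog_add polylog_mult polylog_lg

section \<open>Ball carving\<close>

text \<open>\<open>N v\<close> stands for the neighbourhood in the power graph, later
  \<open>hop_ball G k\<close>. A label that is \<open>None\<close> marks a dead or absent
  node.\<close>

definition red_near :: "(nat \<Rightarrow> nat set) \<Rightarrow> nat \<Rightarrow> labelling \<Rightarrow> nat \<Rightarrow> nat set" where
  "red_near N i lab v = {L. bit L i \<and> (\<exists>u\<in>N v. lab u = Some L)}"

definition request :: "(nat \<Rightarrow> nat set) \<Rightarrow> nat \<Rightarrow> labelling \<Rightarrow> nat \<Rightarrow> nat option" where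
  "request N i lab v = (case lab v of None \<Rightarrow> None
     | Some M \<Rightarrow> if bit M i \<or> red_near N i lab v = {} then None
                else Some (LEAST L. L \<in> red_near N i lab v))"

definition requesters :: "(nat \<Rightarrow> nat set) \<Rightarrow> nat \<Rightarrow> labelling \<Rightarrow> nat \<Rightarrow> nat set" where
  "requesters N i lab L = {v. request N i lab v = Some L}"

definition cluster :: "labelling \<Rightarrow> nat \<Rightarrow> nat set" where
  "cluster lab L = {v. lab v = Some L}"

text \<open>All requests are answered from the same old labelling. The test is growth by the factor
  \<open>1 + 1/B\<close>, cleared of denominators.\<close>

definition join :: "(nat \<Rightarrow> nat set) \<Rightarrow> nat \<Rightarrow> nat \<Rightarrow> labelling \<Rightarrow> labelling" where
  "join N B i lab v = (case request N i lab v of None \<Rightarrow> lab v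
     | Some L \<Rightarrow> if card (cluster lab L) \<le> B * card (requesters N i lab L) then Some L else None)"

lemma requestD:
  assumes "request N i lab v = Some L"
  shows "\<exists>M. lab v = Some M \<and> \<not> bit M i" "bit L i" "\<exists>u\<in>N v. lab u = Some L"
proof -
  from assms obtain M where M: "lab v = Some M" "\<not> bit M i" "red_near N i lab v \<noteq> {}"
    "L = (LEAST L. L \<in> red_near N i lab v)"
    by (auto simp: request_def split: option.splits if_splits)
  then show "\<exists>M. lab v = Some M \<and> \<not> bit M i" by blast
  from M(3,4) have "L \<in> red_near N i lab v"
    by (metis LeastI ex_in_conv)
  then show "bit L i" "\<exists>u\<in>N v. lab u = Some L"
    by (auto simp: red_near_def)
qed

lemma request_eq_None:
  assumes "lab v = Some M" "request N i lab v = None" "\<not> bit M i"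
  shows "red_near N i lab v = {}"
  using assms by (auto simp: request_def split: if_splits)

lemma join_red: "lab v = Some L \<Longrightarrow> bit L i \<Longrightarrow> join N B i lab v = Some L"
  by (simp add: join_def request_def)

lemma join_blueD:
  assumes "join N B i lab v = Some M" "\<not> bit M i"
  shows "lab v = Some M" "request N i lab v = None"
  using assms requestD(2)[of N i lab v] by (auto simp: join_def split: option.splits if_splits)

lemma dom_join: "dom (join N B i lab) \<subseteq> dom lab"
  using requestD(1)[of N i lab] by (fastforce simp: join_def split: option.splits if_splits)

lemma join_SomeD:
  assumes "join N B i lab v = Some L"
  shows "lab v = Some L \<or> (\<exists>u\<in>N v. lab u = Some L)"
  using assms requestD(3)[of N i lab v] by (auto simp: join_def split: option.splits if_splits)

definition active :: "(nat \<Rightarrow> nat set) \<Rightarrow> nat \<Rightarrow> labelling \<Rightarrow> nat \<Rightarrow> bool" where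
  "active N i lab L \<longleftrightarrow> bit L i \<and> (\<exists>v u M. u \<in> N v \<and> lab u = Some L \<and> lab v = Some M \<and> \<not> bit M i)"

lemma active_requesters: "requesters N i lab L \<noteq> {} \<Longrightarrow> active N i lab L"
  using requestD[of N i lab _ L] by (fastforce simp: requesters_def active_def)

lemma requesters_cluster_disjoint: "requesters N i lab L \<inter> cluster lab L = {}"
  using requestD[of N i lab _ L] by (fastforce simp: requesters_def cluster_def)

lemma finite_cluster: "finite (dom lab) \<Longrightarrow> finite (cluster lab L)"
  by (rule finite_subset[of _ "dom lab"]) (auto simp: cluster_def)

lemma finite_requesters: "finite (dom lab) \<Longrightarrow> finite (requesters N i lab L)"
  by (rule finite_subset[of _ "dom lab"]) (use requestD(1) in \<open>fastforce simp: requesters_def\<close>)+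

text \<open>A blue node next to a red one joins a red cluster or dies at once. So a cluster that still has
  a blue neighbour after a step has just acquired the node that touches this neighbour.\<close>

lemma active_joinD:
  assumes act: "active N i (join N B i lab) L" and fin: "finite (dom lab)"
  shows "active N i lab L" "card (cluster lab L) \<le> B * card (requesters N i lab L)"
    "(B + 1) * card (cluster lab L) \<le> B * card (cluster (join N B i lab) L)"
proof -
  obtain v u M where v: "bit L i" "u \<in> N v" "join N B i lab u = Some L" "join N B i lab v = Some M"
    "\<not> bit M i"
    using act by (auto simp: active_def)
  have "red_near N i lab v = {}"
    using join_blueD[OF v(4,5)] v(5) request_eq_None by blast
  then have "lab u \<noteq> Some L"
    using v by (auto simp: red_near_def)
  then have req: "request N i lab u = Some L" and le: "card (cluster lab L) \<le> B * card (requesters N i lab L)"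
    using v(3) by (auto simp: join_def split: option.splits if_splits)
  then show "active N i lab L"
    by (intro active_requesters) (auto simp: requesters_def)
  show "card (cluster lab L) \<le> B * card (requesters N i lab L)"
    by (fact le)
  have "cluster lab L \<union> requesters N i lab L \<subseteq> cluster (join N B i lab) L"
    using le v(1) join_red[of lab _ L i N B] by (auto simp: cluster_def requesters_def join_def)
  moreover have "finite (cluster (join N B i lab) L)"
    by (intro finite_cluster finite_subset[OF dom_join fin])
  ultimately have "card (cluster lab L \<union> requesters N i lab L) \<le> card (cluster (join N B i lab) L)"
    by (rule card_mono[rotated])
  moreover have "card (cluster lab L \<union> requesters N i lab L) = card (cluster lab L) + card (requesters N i lab L)"
    using requesters_cluster_disjoint[of N i lab L]
    by (intro card_Un_disjoint finite_cluster finite_requesters fin) auto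
  ultimately have "B * (card (cluster lab L) + card (requesters N i lab L)) \<le> B * card (cluster (join N B i lab) L)"
    by (intro mult_le_mono2) simp
  with le show "(B + 1) * card (cluster lab L) \<le> B * card (cluster (join N B i lab) L)"
    by (simp add: algebra_simps)
qed

lemma dom_join_funpow: "dom ((join N B i ^^ t) lab) \<subseteq> dom lab"
proof (induction t)
  case (Suc t)
  then show ?case using dom_join[of N B i "(join N B i ^^ t) lab"] by auto
qed simp

text \<open>Activity after \<open>t\<close> steps forces activity after every earlier step, so the
  cluster has grown by the factor \<open>1 + 1/B\<close> each time.\<close>

lemma active_growth:
  assumes "active N i ((join N B i ^^ t) lab) L" "finite (dom lab)"
  shows "active N i lab L \<and>
    (B + 1) ^ t * card (cluster lab L) \<le> B ^ t * card (cluster ((join N B i ^^ t) lab) L)"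
  using assms(1)
proof (induction t)
  case (Suc t)
  let ?l = "(join N B i ^^ t) lab"
  have fin: "finite (dom ?l)"
    using dom_join_funpow assms(2) by (rule finite_subset)
  have act: "active N i (join N B i ?l) L"
    using Suc.prems by simp
  have "(B + 1) ^ Suc t * card (cluster lab L) = (B + 1) * ((B + 1) ^ t * card (cluster lab L))"
    by (simp only: power_Suc mult.assoc)
  also have "\<dots> \<le> (B + 1) * (B ^ t * card (cluster ?l L))"
    using Suc.IH active_joinD(1)[OF act fin] by (intro mult_le_mono2) blast
  also have "\<dots> = B ^ t * ((B + 1) * card (cluster ?l L))"
    by (simp only: mult.left_commute)
  also have "\<dots> \<le> B ^ t * (B * card (cluster (join N B i ?l) L))"
    using active_joinD(3)[OF act fin] by (intro mult_le_mono2)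
  also have "\<dots> = B ^ Suc t * card (cluster ((join N B i ^^ Suc t) lab) L)"
    by simp
  finally show ?case
    using Suc.IH active_joinD(1)[OF act fin] by blast
qed simp

text \<open>Bernoulli's inequality: \<open>B\<close> growth steps by the factor
  \<open>1 + 1/B\<close> at least double a cluster.\<close>

lemma two_mult_power_le: "B \<ge> 1 \<Longrightarrow> 2 * B ^ B \<le> (B + 1) ^ B" for B :: nat
proof -
  assume B: "B \<ge> 1"
  have "1 + real B * (1 / real B) \<le> (1 + 1 / real B) ^ B"
    by (rule Bernoulli_inequality) (use B in \<open>simp add: order_trans[of _ 0]\<close>)
  then have "2 * real B ^ B \<le> (1 + 1 / real B) ^ B * real B ^ B"
    using B by (intro mult_right_mono) auto
  also have "\<dots> = (real B + 1) ^ B"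
    using B by (simp add: distrib_right flip: power_mult_distrib)
  finally have "real (2 * B ^ B) \<le> real ((B + 1) ^ B)"
    by (simp add: add.commute)
  then show ?thesis by (simp only: of_nat_le_iff)
qed

text \<open>A label still active after \<open>B * l\<close> steps would belong to a cluster that
  started nonempty and doubled \<open>l\<close> times, which is more than the number of live
  nodes.\<close>

lemma not_active_final:
  assumes fin: "finite (dom lab)" and B: "B \<ge> 1" and l: "card (dom lab) < 2 ^ l"
  shows "\<not> active N i ((join N B i ^^ (B * l)) lab) L"
proof
  assume act: "active N i ((join N B i ^^ (B * l)) lab) L"
  let ?l = "(join N B i ^^ (B * l)) lab"
  have *: "active N i lab L"
    "(B + 1) ^ (B * l) * card (cluster lab L) \<le> B ^ (B * l) * card (cluster ?l L)"
    using active_growth[OF act fin] by auto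
  then have "cluster lab L \<noteq> {}"
    by (auto simp: active_def cluster_def)
  then have pos: "1 \<le> card (cluster lab L)"
    using finite_cluster[OF fin] by (simp add: Suc_le_eq card_gt_0_iff)
  have "2 ^ l * B ^ (B * l) = (2 * B ^ B) ^ l"
    by (simp add: power_mult_distrib power_mult)
  also have "\<dots> \<le> ((B + 1) ^ B) ^ l"
    using two_mult_power_le[OF B] by (intro power_mono) auto
  also have "\<dots> \<le> (B + 1) ^ (B * l) * card (cluster lab L)"
    using pos by (simp add: power_mult)
  also have "\<dots> \<le> B ^ (B * l) * card (cluster ?l L)"
    by (fact *(2))
  also have "\<dots> \<le> B ^ (B * l) * card (dom lab)"
  proof (intro mult_le_mono2 card_mono fin)
    show "cluster ?l L \<subseteq> dom lab"
      using dom_join_funpow[of "B * l" N B i lab] by (auto simp: cluster_def)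
  qed
  finally have "2 ^ l \<le> card (dom lab)"
    using B by (simp add: mult.commute)
  with l show False by simp
qed

section \<open>Counting the nodes that die\<close>

definition settled :: "(nat \<Rightarrow> nat set) \<Rightarrow> nat \<Rightarrow> labelling \<Rightarrow> nat set" where
  "settled N i lab = {v. \<exists>L. lab v = Some L \<and> bit L i \<and> \<not> active N i lab L}"

text \<open>The nodes killed by a cluster are charged to its members. They become settled in the same
  step, so no node is charged twice.\<close>

lemma deaths_join:
  assumes fin: "finite (dom lab)"
  shows "B * card (dom lab - dom (join N B i lab)) + card (settled N i lab) \<le>
    card (settled N i (join N B i lab))"
proof -
  let ?j = "join N B i lab"
  \<comment> \<open>The clusters that reject their requesters in this step.\<close>
  define K where "K = {L. requesters N i lab L \<noteq> {} \<and> B * card (requesters N i lab L) < card (cluster lab L)}"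
  have finK: "finite K"
  proof (rule finite_subset)
    show "K \<subseteq> (\<lambda>v. the (lab v)) ` dom lab"
      using requestD(3)[of N i lab] by (force simp: K_def requesters_def)
  qed (use fin in simp)
  have "dom lab - dom ?j \<subseteq> (\<Union>L\<in>K. requesters N i lab L)"
  proof
    fix v assume v: "v \<in> dom lab - dom ?j"
    then obtain L where L: "request N i lab v = Some L" "B * card (requesters N i lab L) < card (cluster lab L)"
      by (auto simp: join_def split: option.splits if_splits)
    then have "v \<in> requesters N i lab L"
      by (simp add: requesters_def)
    with L show "v \<in> (\<Union>L\<in>K. requesters N i lab L)"
      by (auto simp: K_def)
  qed
  then have "card (dom lab - dom ?j) \<le> card (\<Union>L\<in>K. requesters N i lab L)"
    using finK finite_requesters[OF fin] by (intro card_mono) auto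
  also have "\<dots> \<le> (\<Sum>L\<in>K. card (requesters N i lab L))"
    using finK by (rule card_UN_le)
  finally have "B * card (dom lab - dom ?j) \<le> B * (\<Sum>L\<in>K. card (requesters N i lab L))"
    by (rule mult_le_mono2)
  also have "\<dots> \<le> (\<Sum>L\<in>K. card (cluster lab L))"
    unfolding sum_distrib_left by (intro sum_mono) (auto simp: K_def)
  also have "\<dots> = card (\<Union>L\<in>K. cluster lab L)"
    using finK finite_cluster[OF fin] by (intro card_UN_disjoint[symmetric]) (auto simp: cluster_def)
  finally have "B * card (dom lab - dom ?j) + card (settled N i lab) \<le>
      card (\<Union>L\<in>K. cluster lab L) + card (settled N i lab)"
    by simp
  also have "\<dots> = card ((\<Union>L\<in>K. cluster lab L) \<union> settled N i lab)"
  proof (rule card_Un_disjoint[symmetric])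
    show "finite (settled N i lab)"
      using fin by (rule finite_subset[rotated]) (auto simp: settled_def)
    show "(\<Union>L\<in>K. cluster lab L) \<inter> settled N i lab = {}"
    proof (intro equals0I)
      fix v assume "v \<in> (\<Union>L\<in>K. cluster lab L) \<inter> settled N i lab"
      then obtain L where "L \<in> K" "\<not> active N i lab L"
        by (auto simp: cluster_def settled_def)
      then show False
        using active_requesters[of N i lab L] by (simp add: K_def)
    qed
  qed (use finK finite_cluster[OF fin] in auto)
  also have "\<dots> \<le> card (settled N i ?j)"
  proof (rule card_mono)
    show "finite (settled N i ?j)"
      using finite_subset[OF dom_join fin] by (rule finite_subset[rotated]) (auto simp: settled_def)
    show "(\<Union>L\<in>K. cluster lab L) \<union> settled N i lab \<subseteq> settled N i ?j"
    proof
      fix v assume "v \<in> (\<Union>L\<in>K. cluster lab L) \<union> settled N i lab"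
      then obtain L where L: "lab v = Some L" "bit L i" "L \<in> K \<or> \<not> active N i lab L"
        using active_requesters[of N i lab]
        by (auto simp: K_def cluster_def settled_def active_def)
      \<comment> \<open>A cluster that is active after the step was active before and passed the
        growth test. Clusters in \<open>K\<close> fail the test, settled ones were not
        active.\<close>
      have "\<not> active N i ?j L"
        using active_joinD(1,2)[OF _ fin, of N i B L] L(3) by (auto simp: K_def)
      then show "v \<in> settled N i ?j"
        using L join_red[of lab v L i N B, OF L(1,2)] by (auto simp: settled_def)
    qed
  qed
  finally show ?thesis .
qed

text \<open>Summed over the steps, the charges stay below the number of settled nodes, which are
  among the nodes alive at the start.\<close>

lemma deaths_phase:
  assumes fin: "finite (dom lab)"
  shows "B * card (dom lab - dom ((join N B i ^^ t) lab)) \<le> card (dom lab)"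
proof -
  have "B * card (dom lab - dom ((join N B i ^^ t) lab)) \<le> card (settled N i ((join N B i ^^ t) lab))"
  proof (induction t)
    case (Suc t)
    let ?l = "(join N B i ^^ t) lab"
    have fin': "finite (dom ?l)"
      using dom_join_funpow fin by (rule finite_subset)
    have "dom lab - dom (join N B i ?l) \<subseteq> (dom lab - dom ?l) \<union> (dom ?l - dom (join N B i ?l))"
      by auto
    then have "card (dom lab - dom (join N B i ?l)) \<le> card ((dom lab - dom ?l) \<union> (dom ?l - dom (join N B i ?l)))"
      using fin fin' by (intro card_mono) auto
    also have "\<dots> \<le> card (dom lab - dom ?l) + card (dom ?l - dom (join N B i ?l))"
      by (rule card_Un_le)
    finally have "B * card (dom lab - dom (join N B i ?l)) \<le>
        B * card (dom lab - dom ?l) + B * card (dom ?l - dom (join N B i ?l))"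
      by (simp flip: add_mult_distrib2)
    then show ?case
      using Suc.IH deaths_join[OF fin', of B N i] by simp
  qed simp
  also have "\<dots> \<le> card (dom lab)"
    using dom_join_funpow[of t N B i lab] by (intro card_mono fin) (auto simp: settled_def)
  finally show ?thesis .
qed

section \<open>Agreement of neighbouring labels, bit by bit\<close>

definition separated :: "(nat \<Rightarrow> nat set) \<Rightarrow> nat \<Rightarrow> labelling \<Rightarrow> bool" where
  "separated N i lab \<longleftrightarrow>
     (\<forall>v u L M. u \<in> N v \<longrightarrow> lab u = Some L \<longrightarrow> lab v = Some M \<longrightarrow> take_bit i L = take_bit i M)"

text \<open>A node takes over a label only from a neighbour, which already agrees with it on the
  bits below \<open>i\<close>. So these bits never change at a surviving node.\<close>

lemma join_separated:
  assumes sep: "separated N i lab"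
  shows "separated N i (join N B i lab)"
proof -
  have pre: "\<exists>M. lab v = Some M \<and> take_bit i M = take_bit i L" if "join N B i lab v = Some L" for v L
  proof (cases "request N i lab v")
    case None
    then show ?thesis using that by (simp add: join_def)
  next
    case (Some L')
    then have "L' = L"
      using that by (simp add: join_def split: if_splits)
    then show ?thesis
      using requestD[OF Some] sep by (fastforce simp: separated_def)
  qed
  show ?thesis
    unfolding separated_def
  proof (intro allI impI)
    fix v u L M assume *: "u \<in> N v" "join N B i lab u = Some L" "join N B i lab v = Some M"
    then obtain L' M' where "lab u = Some L'" "take_bit i L' = take_bit i L"
      "lab v = Some M'" "take_bit i M' = take_bit i M"
      using pre by meson
    then show "take_bit i L = take_bit i M"
      using sep *(1) by (metis separated_def)
  qed
qed

primrec carve :: "(nat \<Rightarrow> nat set) \<Rightarrow> nat \<Rightarrow> nat \<Rightarrow> labelling \<Rightarrow> nat \<Rightarrow> labelling" where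
  "carve N B R lab 0 = lab"
| "carve N B R lab (Suc i) = (join N B i ^^ R) (carve N B R lab i)"

lemma dom_carve: "dom (carve N B R lab i) \<subseteq> dom lab"
proof (induction i)
  case (Suc i)
  then show ?case using dom_join_funpow[of R N B i "carve N B R lab i"] by auto
qed simp

text \<open>Phase \<open>i\<close> preserves the agreement on lower bits, and at its end no red
  cluster has a blue neighbour, which adds agreement on bit \<open>i\<close>.\<close>

lemma carve_separated:
  assumes sym: "\<And>u v. u \<in> N v \<Longrightarrow> v \<in> N u" and fin: "finite (dom lab)" and B: "B \<ge> 1"
    and l: "card (dom lab) < 2 ^ l"
  shows "separated N i (carve N B (B * l) lab i)"
proof (induction i)
  case 0
  then show ?case by (simp add: separated_def)
next
  case (Suc i)
  let ?c = "carve N B (B * l) lab i"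
  have fin': "finite (dom ?c)"
    using dom_carve fin by (rule finite_subset)
  have "card (dom ?c) \<le> card (dom lab)"
    using dom_carve fin by (rule card_mono[rotated])
  then have na: "\<not> active N i ((join N B i ^^ (B * l)) ?c) L" for L
    using l by (intro not_active_final fin' B) simp
  have "separated N i ((join N B i ^^ t) ?c)" for t
    by (induction t) (simp_all add: Suc.IH join_separated)
  then have sep: "separated N i ((join N B i ^^ (B * l)) ?c)" .
  show ?case
    unfolding separated_def
  proof (intro allI impI)
    fix v u L M
    assume *: "u \<in> N v" "carve N B (B * l) lab (Suc i) u = Some L" "carve N B (B * l) lab (Suc i) v = Some M"
    then have "take_bit i L = take_bit i M"
      using sep by (auto simp: separated_def)
    \<comment> \<open>Either end may be the red one; symmetry of \<open>N\<close> covers both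
      cases.\<close>
    moreover have "bit L i = bit M i"
      using na[of L] na[of M] * sym[OF *(1)] by (fastforce simp: active_def)
    ultimately show "take_bit (Suc i) L = take_bit (Suc i) M"
      by (simp add: take_bit_Suc_from_most)
  qed
qed

text \<open>Each phase kills at most a \<open>1/B\<close> fraction of the nodes still alive, and
  these are no more than at the start.\<close>

lemma deaths_carve:
  assumes fin: "finite (dom lab)"
  shows "B * card (dom lab - dom (carve N B R lab i)) \<le> i * card (dom lab)"
proof (induction i)
  case (Suc i)
  let ?c = "carve N B R lab i" and ?c' = "carve N B R lab (Suc i)"
  have fin': "finite (dom ?c)"
    using dom_carve fin by (rule finite_subset)
  have "dom lab - dom ?c' \<subseteq> (dom lab - dom ?c) \<union> (dom ?c - dom ?c')"
    by auto
  then have "card (dom lab - dom ?c') \<le> card ((dom lab - dom ?c) \<union> (dom ?c - dom ?c'))"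
    using fin fin' by (intro card_mono) auto
  also have "\<dots> \<le> card (dom lab - dom ?c) + card (dom ?c - dom ?c')"
    by (rule card_Un_le)
  finally have "B * card (dom lab - dom ?c') \<le> B * card (dom lab - dom ?c) + B * card (dom ?c - dom ?c')"
    by (simp flip: add_mult_distrib2)
  moreover have "B * card (dom ?c - dom ?c') \<le> card (dom ?c)"
    using deaths_phase[OF fin', of B R N i] by simp
  moreover have "card (dom ?c) \<le> card (dom lab)"
    using dom_carve fin by (rule card_mono[rotated])
  ultimately show ?case
    using Suc.IH by simp
qed simp

definition singletons :: "nat set \<Rightarrow> labelling" where
  "singletons S v = (if v \<in> S then Some v else None)"

lemma dom_singletons [simp]: "dom (singletons S) = S"
  by (auto simp: singletons_def split: if_splits)

section \<open>Colour classes by repeated carving\<close>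

primrec uncoloured :: "(nat \<Rightarrow> nat set) \<Rightarrow> nat \<Rightarrow> nat \<Rightarrow> nat \<Rightarrow> nat set \<Rightarrow> nat \<Rightarrow> nat set" where
  "uncoloured N B R b V 0 = V"
| "uncoloured N B R b V (Suc j) = uncoloured N B R b V j -
     dom (carve N B R (singletons (uncoloured N B R b V j)) b)"

lemma uncoloured_subset: "uncoloured N B R b V j \<subseteq> V"
  by (induction j) auto

lemma uncoloured_antimono: "i \<le> j \<Longrightarrow> uncoloured N B R b V j \<subseteq> uncoloured N B R b V i"
  by (rule lift_Suc_antimono_le) auto

text \<open>With \<open>B = 2 * b\<close> and \<open>b\<close> phases, at most
  \<open>b / (2 * b)\<close> of the nodes die, so each colour leaves at most half of them.\<close>

lemma card_uncoloured:
  assumes "finite V" "b \<ge> 1"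
  shows "2 ^ j * card (uncoloured N (2 * b) R b V j) \<le> card V"
proof (induction j)
  case (Suc j)
  let ?U = "uncoloured N (2 * b) R b V"
  have "finite (?U j)"
    using uncoloured_subset assms(1) by (rule finite_subset)
  then have "2 * b * card (?U (Suc j)) \<le> b * card (?U j)"
    using deaths_carve[of "singletons (?U j)" "2 * b" N R b] by simp
  then have "2 * card (?U (Suc j)) \<le> card (?U j)"
    using assms(2) by simp
  then have "2 ^ j * (2 * card (?U (Suc j))) \<le> 2 ^ j * card (?U j)"
    by (rule mult_le_mono2)
  with Suc.IH show ?case
    unfolding power_Suc by (simp only: mult.assoc mult.left_commute)
qed simp

lemma uncoloured_empty:
  assumes "finite V" "b \<ge> 1" "card V < 2 ^ l"
  shows "uncoloured N (2 * b) R b V l = {}"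
proof -
  have "2 ^ l * card (uncoloured N (2 * b) R b V l) < 2 ^ l * 1"
    using card_uncoloured[OF assms(1,2), of l N R] assms(3) by linarith
  then have "card (uncoloured N (2 * b) R b V l) = 0"
    by (simp only: mult_less_cancel1) simp
  then show ?thesis
    using finite_subset[OF uncoloured_subset assms(1)] by (metis card_0_eq)
qed

section \<open>Network decomposition\<close>

text \<open>Distances are taken in the whole network, not inside the cluster, so only the weak
  diameter is controlled.\<close>

definition near :: "network \<Rightarrow> nat \<Rightarrow> labelling \<Rightarrow> bool" where
  "near G d lab \<longleftrightarrow> (\<forall>v L. lab v = Some L \<longrightarrow> v \<in> hop_ball G d L)"

lemma near_mono: "near G d lab \<Longrightarrow> d \<le> e \<Longrightarrow> near G e lab"
  unfolding near_def using hop_ball_mono by blast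

text \<open>A joining node takes its label from a node at most \<open>k\<close> hops away, so one
  step costs \<open>k\<close> hops.\<close>

lemma near_join:
  assumes "network c G" "near G d lab"
  shows "near G (d + k) (join (hop_ball G k) B i lab)"
  unfolding near_def
proof (intro allI impI)
  fix v L assume "join (hop_ball G k) B i lab v = Some L"
  then consider "lab v = Some L" | u where "u \<in> hop_ball G k v" "lab u = Some L"
    using join_SomeD by blast
  then show "v \<in> hop_ball G (d + k) L"
  proof cases
    case 1
    then show ?thesis
      using near_mono[OF assms(2)] by (simp add: near_def)
  next
    case 2
    have "u \<in> hop_ball G d L"
      using 2 assms(2) by (simp add: near_def)
    moreover have "v \<in> hop_ball G k u"
      using hop_ball_sym[OF assms(1)] 2 by blast
    ultimately show ?thesis
      by (rule hop_ball_add)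
  qed
qed

lemma near_join_funpow:
  assumes "network c G" "near G d lab"
  shows "near G (d + k * t) ((join (hop_ball G k) B i ^^ t) lab)"
proof (induction t)
  case (Suc t)
  then show ?case
    using near_join[OF assms(1) Suc, of k B i] by (simp add: ac_simps)
qed (use assms(2) in simp)

lemma near_carve:
  assumes "network c G" "near G d lab"
  shows "near G (d + k * (i * R)) (carve (hop_ball G k) B R lab i)"
proof (induction i)
  case (Suc i)
  then show ?case
    using near_join_funpow[OF assms(1), of "d + k * (i * R)" _ k R] by (simp add: algebra_simps)
qed (use assms(2) in simp)

lemma near_singletons: "S \<subseteq> pverts G \<Longrightarrow> near G 0 (singletons S)"
  by (auto simp: near_def singletons_def split: if_splits)

text \<open>Identifiers are below \<open>(n + 1) ^ c\<close>, which is at most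
  \<open>2 ^ (c * lg n)\<close>. The \<open>+ 1\<close> keeps the number of phases positive.\<close>

definition nd_bits :: "nat \<Rightarrow> nat \<Rightarrow> nat" where
  "nd_bits c n = c * lg n + 1"

text \<open>The phase length \<open>B * l\<close> of \<open>not_active_final\<close>, with
  \<open>B = 2 * nd_bits c n\<close> and \<open>l = lg n\<close>.\<close>

definition nd_steps :: "nat \<Rightarrow> nat \<Rightarrow> nat" where
  "nd_steps c n = 2 * nd_bits c n * lg n"

definition nd_radius :: "nat \<Rightarrow> nat \<Rightarrow> nat \<Rightarrow> nat" where
  "nd_radius c k n = k * (nd_bits c n * nd_steps c n)"

abbreviation carving :: "nat \<Rightarrow> nat \<Rightarrow> network \<Rightarrow> labelling \<Rightarrow> nat \<Rightarrow> labelling" where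
  "carving c k G \<equiv>
     carve (hop_ball G k) (2 * nd_bits c (card (pverts G))) (nd_steps c (card (pverts G)))"

definition leftover :: "nat \<Rightarrow> nat \<Rightarrow> network \<Rightarrow> nat \<Rightarrow> nat set" where
  "leftover c k G = uncoloured (hop_ball G k) (2 * nd_bits c (card (pverts G)))
     (nd_steps c (card (pverts G))) (nd_bits c (card (pverts G))) (pverts G)"

definition nd_label :: "nat \<Rightarrow> nat \<Rightarrow> network \<Rightarrow> nat \<Rightarrow> labelling" where
  "nd_label c k G j = carving c k G (singletons (leftover c k G j)) (nd_bits c (card (pverts G)))"

text \<open>The index of the first carving that \<open>v\<close> survives; survivors of carving
  \<open>j\<close> are missing from leftover \<open>Suc j\<close>.\<close>

definition colour :: "nat \<Rightarrow> nat \<Rightarrow> network \<Rightarrow> nat \<Rightarrow> nat" where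
  "colour c k G v = (LEAST j. v \<notin> leftover c k G (Suc j))"

lemma leftover_Suc: "leftover c k G (Suc j) = leftover c k G j - dom (nd_label c k G j)"
  by (simp add: leftover_def nd_label_def)

lemma leftover_subset: "leftover c k G j \<subseteq> pverts G"
  unfolding leftover_def by (rule uncoloured_subset)

lemma leftover_empty:
  assumes "network c G" "lg (card (pverts G)) \<le> j"
  shows "leftover c k G j = {}"
proof -
  have "leftover c k G (lg (card (pverts G))) = {}"
    unfolding leftover_def using network_facts(1)[OF assms(1)] less_two_power_lg
    by (intro uncoloured_empty) (auto simp: nd_bits_def)
  then show ?thesis
    using uncoloured_antimono[OF assms(2)] unfolding leftover_def by blast
qed

lemma colour_bound:
  assumes "network c G" "v \<in> pverts G"
  shows "colour c k G v < lg (card (pverts G))"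
proof -
  have "lg (card (pverts G)) \<noteq> 0"
    using leftover_empty[OF assms(1), of 0 k] assms(2) by (auto simp: leftover_def)
  then obtain m where m: "lg (card (pverts G)) = Suc m"
    using not0_implies_Suc by blast
  then have "v \<notin> leftover c k G (Suc m)"
    using leftover_empty[OF assms(1)] by simp
  then have "colour c k G v \<le> m"
    unfolding colour_def by (rule Least_le)
  with m show ?thesis by simp
qed

lemma nd_label_colour:
  assumes "network c G" "v \<in> pverts G"
  shows "v \<in> dom (nd_label c k G (colour c k G v))"
proof -
  let ?j = "colour c k G v"
  have "\<exists>j. v \<notin> leftover c k G (Suc j)"
    using leftover_empty[OF assms(1), of "Suc (lg (card (pverts G)))"] by (auto intro!: exI[of _ "lg (card (pverts G))"])
  then have "v \<notin> leftover c k G (Suc ?j)"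
    unfolding colour_def by (rule LeastI_ex)
  moreover have "v \<in> leftover c k G ?j"
  proof (cases ?j)
    case 0
    then show ?thesis using assms(2) by (simp add: leftover_def)
  next
    case (Suc m)
    then show ?thesis
      using not_less_Least[of m "\<lambda>j. v \<notin> leftover c k G (Suc j)"] by (simp add: colour_def)
  qed
  ultimately show ?thesis by (simp add: leftover_Suc)
qed

lemma near_nd_label:
  assumes "network c G"
  shows "near G (nd_radius c k (card (pverts G))) (nd_label c k G j)"
  using near_carve[OF assms near_singletons[OF leftover_subset], of k]
  by (simp add: nd_label_def nd_radius_def)

lemma same_cluster_near:
  assumes "network c G" "nd_label c k G j u = Some L" "nd_label c k G j v = Some L"
  shows "u \<in> hop_ball G (2 * nd_radius c k (card (pverts G))) v"
proof -
  let ?d = "nd_radius c k (card (pverts G))"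
  have "u \<in> hop_ball G ?d L" "L \<in> hop_ball G ?d v"
    using near_nd_label[OF assms(1)] assms hop_ball_sym[OF assms(1)] by (auto simp: near_def)
  then show ?thesis
    unfolding mult_2 by (rule hop_ball_add[rotated])
qed

text \<open>Carving yields agreement on the lowest \<open>nd_bits\<close> bits. Every label names a
  vertex within bounded distance, and vertex identifiers fit into that many bits, so agreement means
  equality.\<close>

lemma adjacent_same_cluster:
  assumes "network c G" "nd_label c k G j u = Some L" "nd_label c k G j v = Some M"
    "u \<in> hop_ball G k v"
  shows "L = M"
proof -
  let ?n = "card (pverts G)"
  let ?b = "nd_bits c ?n"
  have "card (leftover c k G j) \<le> ?n"
    using leftover_subset network_facts(1)[OF assms(1)] by (rule card_mono[rotated])
  then have "separated (hop_ball G k) ?b (nd_label c k G j)"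
    unfolding nd_label_def nd_steps_def
    using hop_ball_sym[OF assms(1)] less_two_power_lg[of ?n]
      finite_subset[OF leftover_subset network_facts(1)[OF assms(1)], of c k j]
    by (intro carve_separated) (auto simp: nd_bits_def)
  then have "take_bit ?b L = take_bit ?b M"
    using assms(2-4) by (auto simp: separated_def)
  moreover have "take_bit ?b L' = L'" if "nd_label c k G j w = Some L'" for w L'
  proof -
    have "w \<in> hop_ball G (nd_radius c k ?n) L'"
      using near_nd_label[OF assms(1)] that by (simp add: near_def)
    then have "L' \<in> pverts G"
      by (rule hop_ball_center_verts[OF assms(1)])
    then have "L' < (?n + 1) ^ c"
      by (rule network_facts(5)[OF assms(1)])
    also have "\<dots> \<le> (2 ^ lg ?n) ^ c"
      using less_two_power_lg[of ?n] by (intro power_mono) auto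
    also have "\<dots> = 2 ^ (c * lg ?n)"
      by (simp only: mult.commute[of c] power_mult)
    also have "\<dots> \<le> 2 ^ ?b"
      by (simp add: nd_bits_def)
    finally show ?thesis
      by (simp add: take_bit_nat_eq_self)
  qed
  ultimately show ?thesis
    using assms(2,3) by metis
qed

section \<open>Locality of the decomposition\<close>

locale two_networks =
  fixes c :: nat and G G' :: network and x x' :: labelling
  assumes net: "network c G" and net': "network c G'" and card_eq: "card (pverts G) = card (pverts G')"
begin

text \<open>Locality without algorithms: \<open>f\<close> and \<open>f'\<close> are the same
  construction carried out in the two networks, and equal views must give equal values.\<close>

definition agree :: "nat \<Rightarrow> (nat \<Rightarrow> 'a) \<Rightarrow> (nat \<Rightarrow> 'a) \<Rightarrow> bool" where
  "agree r f f' \<longleftrightarrow> (\<forall>v. same_view r G x G' x' v \<longrightarrow> f v = f' v)"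

lemma agree_mono: "agree r f f' \<Longrightarrow> r \<le> s \<Longrightarrow> agree s f f'"
  unfolding agree_def using same_view_mono[OF net net'] by blast

lemma agreeD:
  assumes "agree a f f'" "same_view (a + r) G x G' x' v" "u \<in> hop_ball G r v"
  shows "f u = f' u"
  using assms same_view_sub[OF net net' assms(2,3)] by (auto simp: agree_def)

lemma hop_ball_eq:
  assumes "same_view r G x G' x' v" "s \<le> r"
  shows "hop_ball G s v = hop_ball G' s v"
  using same_view_mono[OF net net' assms] by (simp add: same_view_def)

lemma agree_request:
  assumes "agree a lab lab'"
  shows "agree (a + k) (request (hop_ball G k) i lab) (request (hop_ball G' k) i lab')"
  unfolding agree_def
proof (intro allI impI)
  fix v assume v: "same_view (a + k) G x G' x' v"
  then have "v \<in> hop_ball G k v"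
    by (simp add: same_view_def)
  then have "lab v = lab' v" "hop_ball G k v = hop_ball G' k v"
    "\<forall>u\<in>hop_ball G k v. lab u = lab' u"
    using agreeD[OF assms v] hop_ball_eq[OF v] by auto
  then have "red_near (hop_ball G k) i lab v = red_near (hop_ball G' k) i lab' v"
    by (auto simp: red_near_def)
  then show "request (hop_ball G k) i lab v = request (hop_ball G' k) i lab' v"
    unfolding request_def \<open>lab v = lab' v\<close> by (simp only:)
qed

text \<open>If \<open>v\<close> asks to join \<open>L\<close>, a member is within \<open>k\<close>
  hops, the node \<open>L\<close> within \<open>d\<close> more, and every other member within
  \<open>d\<close> more. Requesters are \<open>k\<close> hops from a member, and evaluating their
  requests takes another \<open>k\<close> hops.\<close>

lemma agree_join:
  assumes lab: "agree a lab lab'" and near: "near G d lab" "near G' d lab'"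
  shows "agree (a + (3 * k + 2 * d)) (join (hop_ball G k) B i lab) (join (hop_ball G' k) B i lab')"
  unfolding agree_def
proof (intro allI impI)
  let ?N = "hop_ball G k" and ?N' = "hop_ball G' k"
  fix v assume v: "same_view (a + (3 * k + 2 * d)) G x G' x' v"
  have lab_eq: "lab u = lab' u" if "u \<in> hop_ball G (3 * k + 2 * d) v" for u
    using agreeD[OF lab v that] .
  have "same_view ((a + k) + (2 * k + 2 * d)) G x G' x' v"
    using v by (rule back_subst[of "\<lambda>r. same_view r G x G' x' v"]) simp
  note req_eq = agreeD[OF agree_request[OF lab] this, of _ i]
  have sub: "hop_ball G r v \<subseteq> hop_ball G s v" if "r \<le> s" for r s
    using that by (rule hop_ball_mono)
  have cv: "v \<in> hop_ball G r v" for r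
    using v by (simp add: same_view_def)
  show "join ?N B i lab v = join ?N' B i lab' v"
  proof (cases "request ?N i lab v")
    case None
    then show ?thesis
      using req_eq[OF cv] lab_eq[OF cv] by (simp add: join_def)
  next
    case (Some L)
    have req': "request ?N' i lab' v = Some L"
      using Some req_eq[OF cv] by simp
    \<comment> \<open>Stated for both networks, since the cluster has to be located in each of them
      before the two can be compared.\<close>
    have ball: "w \<in> hop_ball H (k + 2 * d) v"
      if H: "network c H" "near H d l" "request (hop_ball H k) i l v = Some L" "l w = Some L" for w l H
    proof -
      obtain u where u: "u \<in> hop_ball H k v" "l u = Some L"
        using requestD(3)[OF H(3)] by blast
      have w: "w \<in> hop_ball H d L"
        using H(2,4) by (simp add: near_def)
      have "u \<in> hop_ball H d L"
        using H(2) u(2) by (simp add: near_def)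
      then have "L \<in> hop_ball H d u"
        by (rule hop_ball_sym[OF H(1)])
      have "k + 2 * d = k + d + d"
        by simp
      with hop_ball_add[OF hop_ball_add[OF u(1) \<open>L \<in> hop_ball H d u\<close>] w] show ?thesis
        by (simp only:)
    qed
    have b1: "lab w = Some L \<Longrightarrow> w \<in> hop_ball G (k + 2 * d) v"
      and b2: "lab' w = Some L \<Longrightarrow> w \<in> hop_ball G (k + 2 * d) v" for w
      using ball[OF net near(1) Some] ball[OF net' near(2) req'] hop_ball_eq[OF v, of "k + 2 * d"] by auto
    have lab_eq': "lab w = lab' w" if "w \<in> hop_ball G (k + 2 * d) v" for w
      using lab_eq sub[of "k + 2 * d" "3 * k + 2 * d"] that by auto
    have cl: "cluster lab L = cluster lab' L"
      unfolding cluster_def using b1 b2 lab_eq' by metis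
    have c1: "w \<in> hop_ball G (2 * k + 2 * d) v" if w: "request ?N i lab w = Some L" for w
    proof -
      obtain u where u: "u \<in> hop_ball G k w" "lab u = Some L"
        using requestD(3)[OF w] by blast
      have "2 * k + 2 * d = k + 2 * d + k"
        by simp
      with hop_ball_add[OF b1[OF u(2)] hop_ball_sym[OF net u(1)]] show ?thesis
        by (simp only:)
    qed
    have c2: "w \<in> hop_ball G (2 * k + 2 * d) v" if w: "request ?N' i lab' w = Some L" for w
    proof -
      obtain u where u: "u \<in> hop_ball G' k w" "lab' u = Some L"
        using requestD(3)[OF w] by blast
      have "u \<in> hop_ball G' (k + 2 * d) v"
        using b2[OF u(2)] hop_ball_eq[OF v, of "k + 2 * d"] by simp
      then have "w \<in> hop_ball G' (k + 2 * d + k) v"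
        using hop_ball_sym[OF net' u(1)] by (rule hop_ball_add)
      moreover have "2 * k + 2 * d = k + 2 * d + k"
        by simp
      ultimately show ?thesis
        using hop_ball_eq[OF v, of "k + 2 * d + k"] by (simp only:)
    qed
    have "requesters ?N i lab L = requesters ?N' i lab' L"
      unfolding requesters_def using c1 c2 req_eq by metis
    then show ?thesis
      using Some req' cl lab_eq[OF cv] by (simp add: join_def)
  qed
qed

text \<open>\<open>e\<close> bounds the distance to the label throughout all steps, so every step
  has the same cost.\<close>

lemma agree_join_funpow:
  assumes lab: "agree a lab lab'" and near: "near G d lab" "near G' d lab'"
    and e: "d + k * t \<le> e"
  shows "agree (a + t * (3 * k + 2 * e)) ((join (hop_ball G k) B i ^^ t) lab)
    ((join (hop_ball G' k) B i ^^ t) lab')"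
  using e
proof (induction t)
  case (Suc t)
  let ?l = "(join (hop_ball G k) B i ^^ t) lab" and ?l' = "(join (hop_ball G' k) B i ^^ t) lab'"
  have e: "d + k * t \<le> e"
    using Suc.prems by simp
  have "agree ((a + t * (3 * k + 2 * e)) + (3 * k + 2 * e)) (join (hop_ball G k) B i ?l)
      (join (hop_ball G' k) B i ?l')"
    using near_mono[OF near_join_funpow[OF net near(1)] e]
      near_mono[OF near_join_funpow[OF net' near(2)] e]
    by (intro agree_join Suc.IH e)
  then show ?case
    by (simp add: algebra_simps)
qed (use lab in simp)

lemma agree_carve:
  assumes lab: "agree a lab lab'" and near: "near G d lab" "near G' d lab'"
    and e: "d + k * (i * R) \<le> e"
  shows "agree (a + i * R * (3 * k + 2 * e)) (carve (hop_ball G k) B R lab i)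
    (carve (hop_ball G' k) B R lab' i)"
  using e
proof (induction i)
  case (Suc i)
  have e: "d + k * (i * R) \<le> e" "(d + k * (i * R)) + k * R \<le> e"
    using Suc.prems by (simp_all add: algebra_simps)
  have "agree ((a + i * R * (3 * k + 2 * e)) + R * (3 * k + 2 * e))
      ((join (hop_ball G k) B i ^^ R) (carve (hop_ball G k) B R lab i))
      ((join (hop_ball G' k) B i ^^ R) (carve (hop_ball G' k) B R lab' i))"
    by (rule agree_join_funpow[OF Suc.IH[OF e(1)] near_carve[OF net near(1)] near_carve[OF net' near(2)] e(2)])
  then show ?case
    by (simp add: algebra_simps)
qed (use lab in simp)

end

text \<open>The number of join steps times the locality of one step.\<close>

definition nd_cost :: "nat \<Rightarrow> nat \<Rightarrow> nat \<Rightarrow> nat" where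
  "nd_cost c k n = nd_bits c n * nd_steps c n * (3 * k + 2 * nd_radius c k n)"

context two_networks
begin

lemma agree_singletons:
  assumes "agree a (\<lambda>v. v \<in> S) (\<lambda>v. v \<in> S')"
  shows "agree a (singletons S) (singletons S')"
  using assms by (simp add: agree_def singletons_def)

lemma agree_nd_label:
  assumes "agree a (\<lambda>v. v \<in> leftover c k G j) (\<lambda>v. v \<in> leftover c k G' j)"
  shows "agree (a + nd_cost c k (card (pverts G))) (nd_label c k G j) (nd_label c k G' j)"
  unfolding nd_label_def nd_cost_def card_eq[symmetric]
  by (intro agree_carve[where d = 0] agree_singletons assms near_singletons leftover_subset)
    (simp add: nd_radius_def)

lemma agree_leftover:
  "agree (j * nd_cost c k (card (pverts G))) (\<lambda>v. v \<in> leftover c k G j) (\<lambda>v. v \<in> leftover c k G' j)"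
proof (induction j)
  case 0
  then show ?case
    by (simp add: agree_def leftover_def same_view_def)
next
  case (Suc j)
  have "agree (Suc j * nd_cost c k (card (pverts G))) (nd_label c k G j) (nd_label c k G' j)"
    using agree_nd_label[OF Suc] by (simp add: add.commute)
  moreover have "agree (Suc j * nd_cost c k (card (pverts G))) (\<lambda>v. v \<in> leftover c k G j) (\<lambda>v. v \<in> leftover c k G' j)"
    using Suc by (rule agree_mono) simp
  ultimately show ?case
    by (auto simp: agree_def leftover_Suc dom_def)
qed

lemma agree_colour:
  "agree (lg (card (pverts G)) * nd_cost c k (card (pverts G))) (colour c k G) (colour c k G')"
  unfolding agree_def
proof (intro allI impI)
  fix v assume v: "same_view (lg (card (pverts G)) * nd_cost c k (card (pverts G))) G x G' x' v"
  \<comment> \<open>Beyond index \<open>lg n\<close> both leftovers are empty, so a single radius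
    serves all indices.\<close>
  have "v \<in> leftover c k G j \<longleftrightarrow> v \<in> leftover c k G' j" for j
  proof (cases "j \<le> lg (card (pverts G))")
    case True
    then have "agree (lg (card (pverts G)) * nd_cost c k (card (pverts G)))
        (\<lambda>v. v \<in> leftover c k G j) (\<lambda>v. v \<in> leftover c k G' j)"
      by (intro agree_mono[OF agree_leftover] mult_le_mono1)
    with v show ?thesis
      by (simp add: agree_def)
  next
    case False
    then show ?thesis
      using leftover_empty[OF net] leftover_empty[OF net'] card_eq by simp
  qed
  then show "colour c k G v = colour c k G' v"
    by (simp add: colour_def)
qed

end

section \<open>Simulating SLOCAL algorithms\<close>

lemma foldl_upd_notin: "v \<notin> set vs \<Longrightarrow> foldl (\<lambda>M v. M(v \<mapsto> f M v)) M vs v = M v"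
  by (induction vs arbitrary: M) auto

lemma dom_foldl_upd: "dom (foldl (\<lambda>M v. M(v \<mapsto> f M v)) M vs) = dom M \<union> set vs"
  by (induction vs arbitrary: M) auto

text \<open>No entry is overwritten, so the memory seen by \<open>v\<close> is the final memory
  restricted to the nodes before it.\<close>

lemma foldl_upd_prefix:
  fixes f :: "('a \<rightharpoonup> 'b) \<Rightarrow> 'a \<Rightarrow> 'b"
  assumes "distinct (as @ v # bs)"
    and M_def: "M = foldl (\<lambda>M v. M(v \<mapsto> f M v)) Map.empty (as @ v # bs)"
  shows "M v = Some (f (M |` set as) v)"
proof -
  let ?A = "foldl (\<lambda>M v. M(v \<mapsto> f M v)) Map.empty as"
  have M: "M = foldl (\<lambda>M v. M(v \<mapsto> f M v)) (?A(v \<mapsto> f ?A v)) bs"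
    by (simp add: M_def)
  have "M |` set as = ?A"
  proof
    fix u
    show "(M |` set as) u = ?A u"
    proof (cases "u \<in> set as")
      case True
      then have "u \<notin> set bs" "u \<noteq> v"
        using assms(1) by auto
      then show ?thesis
        using True by (simp add: M foldl_upd_notin)
    qed (simp add: foldl_upd_notin)
  qed
  then show ?thesis
    using assms(1) foldl_upd_notin[of v bs f] by (simp add: M)
qed

definition key_order :: "(nat \<Rightarrow> nat) \<Rightarrow> nat set \<Rightarrow> nat list" where
  "key_order f V = map snd (sorted_list_of_set ((\<lambda>v. (f v, v)) ` V))"

text \<open>The last claim replaces positions in the list by a comparison of keys, so that two nodes
  can find their order locally.\<close>

lemma key_order:
  assumes "finite V"
  shows "set (key_order f V) = V" "distinct (key_order f V)"
    "key_order f V = as @ v # bs \<Longrightarrow> set as = {u \<in> V. (f u, u) < (f v, v)}"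
proof -
  let ?P = "(\<lambda>v. (f v, v)) ` V"
  let ?ps = "sorted_list_of_set ?P"
  have fin: "finite ?P"
    using assms by simp
  have set_ps: "set ?ps = ?P"
    using fin by simp
  show set_eq: "set (key_order f V) = V"
    by (auto simp: key_order_def assms image_image)
  show "distinct (key_order f V)"
    by (auto simp: key_order_def distinct_map set_ps inj_on_def)
  show "set as = {u \<in> V. (f u, u) < (f v, v)}" if s: "key_order f V = as @ v # bs"
  proof -
    obtain ps p qs where ps: "?ps = ps @ p # qs" "map snd ps = as" "snd p = v"
      using s unfolding key_order_def by (fastforce simp: map_eq_append_conv map_eq_Cons_conv)
    have "p \<in> ?P"
      using set_ps ps(1) by (metis in_set_conv_decomp)
    then have p: "p = (f v, v)"
      using ps(3) by auto
    have sorted: "sorted_wrt (<) (ps @ p # qs)"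
      using sorted_list_of_set.strict_sorted_key_list_of_set[of ?P] ps(1) by simp
    have "set ps = {q \<in> ?P. q < p}"
      using sorted set_ps unfolding ps(1) by (force simp: sorted_wrt_append)
    then have "snd ` set ps = {u \<in> V. (f u, u) < (f v, v)}"
      unfolding p by force
    then show ?thesis
      using ps(2) by auto
  qed
qed

definition slocal_memory ::
    "slocal_alg \<Rightarrow> nat \<Rightarrow> network \<Rightarrow> labelling \<Rightarrow> (nat \<Rightarrow> nat) \<Rightarrow> labelling" where
  "slocal_memory A r G x f =
     foldl (\<lambda>M v. M(v \<mapsto> s_process A (slocal_view_of r G x M v))) Map.empty (key_order f (pverts G))"

lemma slocal_memory_rec:
  assumes "network c G" "v \<in> pverts G"
  shows "slocal_memory A r G x f v = Some (s_process A (slocal_view_of r G x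
    (slocal_memory A r G x f |` {u \<in> pverts G. (f u, u) < (f v, v)}) v))"
proof -
  note ko = key_order[OF network_facts(1)[OF assms(1)], of f]
  have "v \<in> set (key_order f (pverts G))"
    using assms(2) ko(1) by simp
  then obtain as bs where s: "key_order f (pverts G) = as @ v # bs"
    by (meson split_list)
  have "distinct (as @ v # bs)"
    using ko(2) s by simp
  moreover have "slocal_memory A r G x f = foldl (\<lambda>M v. M(v \<mapsto> s_process A (slocal_view_of r G x M v)))
      Map.empty (as @ v # bs)"
    by (simp only: slocal_memory_def s)
  ultimately show ?thesis
    unfolding ko(3)[OF s, symmetric] by (rule foldl_upd_prefix)
qed

lemma dom_slocal_memory: "network c G \<Longrightarrow> dom (slocal_memory A r G x f) = pverts G"
  by (simp add: slocal_memory_def dom_foldl_upd key_order network_facts(1))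

context two_networks
begin

lemma slocal_view_eq:
  assumes v: "same_view r G x G' x' v"
    and M: "\<And>u. u \<in> hop_ball G r v \<Longrightarrow> M u = M' u"
  shows "slocal_view_of r G x M v = slocal_view_of r G' x' M' v"
proof -
  have B: "hop_ball G r v = hop_ball G' r v" and nb: "\<And>u. u \<in> hop_ball G r v \<Longrightarrow> nbrs G u = nbrs G' u \<and> x u = x' u"
    using v by (auto simp: same_view_def)
  have "pverts G \<inter> hop_ball G r v = pverts G' \<inter> hop_ball G r v"
    using hop_ball_subset[of G r v] hop_ball_subset[of G' r v] B by blast
  moreover have "parcs G \<inter> hop_ball G r v \<times> hop_ball G r v = parcs G' \<inter> hop_ball G r v \<times> hop_ball G r v"
    using nb by (auto simp: nbrs_def set_eq_iff)
  ultimately have "induced G (hop_ball G r v) = induced G' (hop_ball G' r v)"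
    unfolding B[symmetric] by (simp add: induced_def)
  moreover have "x |` hop_ball G r v = x' |` hop_ball G' r v" "M |` hop_ball G r v = M' |` hop_ball G' r v"
    unfolding B[symmetric] using nb M by (auto simp: restrict_map_def)
  ultimately show ?thesis
    using card_eq by (simp add: slocal_view_of_def)
qed

text \<open>The memory of a node of colour j depends on smaller colours and on nodes of its own cluster:
  clusters of the same colour are more than r hops apart.\<close>

lemma agree_slocal_memory:
  fixes A r
  defines "f \<equiv> colour c r G" and "f' \<equiv> colour c r G'"
    and "M \<equiv> slocal_memory A r G x (colour c r G)" and "M' \<equiv> slocal_memory A r G' x' (colour c r G')"
    and "d \<equiv> 2 * nd_radius c r (card (pverts G)) + r"
    and "C \<equiv> lg (card (pverts G)) * nd_cost c r (card (pverts G))"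
  shows "same_view (C + (f v + 1) * d) G x G' x' v \<Longrightarrow> M v = M' v"
proof (induction "f v" arbitrary: v rule: less_induct)
  case less
  let ?j = "f v" and ?R = "2 * nd_radius c r (card (pverts G))"
  have vV: "v \<in> pverts G"
    using less.prems by (simp add: same_view_def)
  obtain L where L: "nd_label c r G ?j v = Some L"
    using nd_label_colour[OF net vV, of r] by (auto simp: f_def)
  \<comment> \<open>The whole cluster is handled from the single view of \<open>v\<close>, by
    induction on identifiers, which order the nodes of one colour. Chains of dependencies inside the
    cluster thus cost no further radius.\<close>
  have "M u = M' u" if "u \<in> pverts G" "f u = ?j" "nd_label c r G ?j u = Some L" for u
    using that
  proof (induction u rule: less_induct)
    case (less u)
    have u: "u \<in> hop_ball G ?R v"
      using same_cluster_near[OF net less.prems(3) L] .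
    \<comment> \<open>The share \<open>d\<close> of colour \<open>?j\<close> pays \<open>?R\<close>
      hops to reach a cluster member and \<open>r\<close> hops to read around it;
      \<open>C + ?j * d\<close> remains for smaller colours.\<close>
    have sv: "same_view (C + (?j * d + r) + ?R) G x G' x' v"
      using \<open>same_view (C + (?j + 1) * d) G x G' x' v\<close> by (rule back_subst[of "\<lambda>r. same_view r G x G' x' v"]) (simp add: d_def)
    have svu: "same_view (C + ?j * d + r) G x G' x' u"
      using same_view_sub[OF net net' sv u] by (simp add: add.assoc)
    have uV': "u \<in> pverts G'"
      using svu by (simp add: same_view_def)
    have fw: "f w = f' w" and wV': "w \<in> pverts G'" if w: "w \<in> hop_ball G r u" for w
    proof -
      have sw: "same_view (C + ?j * d) G x G' x' w"
        using same_view_sub[OF net net' svu w] .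
      show "f w = f' w"
        using agree_colour[of r] same_view_mono[OF net net' sw, of C]
        by (simp add: agree_def f_def f'_def C_def)
      show "w \<in> pverts G'"
        using sw by (simp add: same_view_def)
    qed
    have uball: "u \<in> hop_ball G r u"
      using less.prems(1) by simp
    have early: "M w = M' w" if w: "w \<in> hop_ball G r u" "(f w, w) < (f u, u)" for w
    proof (cases "f w < ?j")
      case True
      have "same_view (C + ?j * d) G x G' x' w"
        using same_view_sub[OF net net' svu w(1)] .
      moreover have "C + (f w + 1) * d \<le> C + ?j * d"
        using True by (simp add: Suc_leI del: add_mult_distrib mult_Suc)
      ultimately have "same_view (C + (f w + 1) * d) G x G' x' w"
        by (rule same_view_mono[OF net net'])
      then show ?thesis
        using True by (rule \<open>\<And>u. f u < ?j \<Longrightarrow> same_view (C + (f u + 1) * d) G x G' x' u \<Longrightarrow> M u = M' u\<close>[rotated])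
    next
      case False
      then have fw': "f w = ?j" "w < u"
        using w(2) less.prems(2) by (auto simp: less_prod_def')
      have wV: "w \<in> pverts G"
        using w(1) hop_ball_subset by blast
      \<comment> \<open>A node of the same colour within \<open>r\<close> hops has the same label,
        so the inner induction applies to it.\<close>
      obtain L' where L': "nd_label c r G ?j w = Some L'"
        using nd_label_colour[OF net wV, of r] fw' by (auto simp: f_def)
      then have "L' = L"
        using adjacent_same_cluster[OF net _ less.prems(3) w(1)] by blast
      then show ?thesis
        using less.IH[OF fw'(2) wV fw'(1)] L' by simp
    qed
    have "slocal_view_of r G x (M |` {w \<in> pverts G. (f w, w) < (f u, u)}) u =
        slocal_view_of r G' x' (M' |` {w \<in> pverts G'. (f' w, w) < (f' u, u)}) u"
    proof (rule slocal_view_eq)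
      show "same_view r G x G' x' u"
        using same_view_mono[OF net net' svu, of r] by simp
      fix w assume w: "w \<in> hop_ball G r u"
      have "w \<in> pverts G"
        using w hop_ball_subset by blast
      then show "(M |` {w \<in> pverts G. (f w, w) < (f u, u)}) w = (M' |` {w \<in> pverts G'. (f' w, w) < (f' u, u)}) w"
        using early[OF w] fw[OF w] fw[OF uball] wV'[OF w] by (simp add: restrict_map_def)
    qed
    then show ?case
      using slocal_memory_rec[OF net less.prems(1), of A r x f] slocal_memory_rec[OF net' uV', of A r x' f']
      by (simp add: M_def M'_def f_def f'_def)
  qed
  then show ?case
    using vV L by simp
qed

end

text \<open>The locality of the colours, plus one share of \<open>agree_slocal_memory\<close> for
  each of at most \<open>lg n\<close> colours.\<close>

definition sim_rounds :: "nat \<Rightarrow> nat \<Rightarrow> nat \<Rightarrow> nat" where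
  "sim_rounds c k n = lg n * nd_cost c k n + lg n * (2 * nd_radius c k n + k)"

lemma polylog_sim_rounds:
  assumes "polylog (\<lambda>n. real (r n))"
  shows "polylog (\<lambda>n. real (sim_rounds c (r n) n))"
  unfolding sim_rounds_def nd_cost_def nd_radius_def nd_steps_def nd_bits_def
    of_nat_add of_nat_mult of_nat_numeral
  by (intro polylog_intros assms)

text \<open>An SLOCAL algorithm is correct for every order. Ordering by colour in a decomposition of
  the \<open>r\<close>-th power makes its output a function of a polylogarithmic view.\<close>

theorem P_SLOCAL_subset_P_LOCAL: "P_SLOCAL \<subseteq> P_LOCAL"
proof
  fix P assume "P \<in> P_SLOCAL"
  show "P \<in> P_LOCAL"
    unfolding P_LOCAL_def
  proof (intro CollectI allI)
    fix c
    obtain A r where r: "polylog (\<lambda>n. real (r n))" and A: "slocal_solves c A r P"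
      using \<open>P \<in> P_SLOCAL\<close> unfolding P_SLOCAL_def by blast
    define T where "T n = sim_rounds c (r n) n" for n
    define M where "M G x = slocal_memory A (r (card (pverts G))) G x (colour c (r (card (pverts G))) G)" for G and x :: labelling
    have local: "s_out A (the (M G x v)) = s_out A (the (M G' x' v))"
      if *: "network c G" "network c G'" "card (pverts G) = card (pverts G')"
        "same_view (T (card (pverts G))) G x G' x' v" for G G' x x' v
    proof -
      interpret two_networks c G G' x x'
        using * by unfold_locales
      let ?n = "card (pverts G)"
      have "v \<in> pverts G"
        using *(4) by (simp add: same_view_def)
      then have "colour c (r ?n) G v + 1 \<le> lg ?n"
        using colour_bound[OF *(1)] by (simp add: Suc_le_eq)
      then have "lg ?n * nd_cost c (r ?n) ?n + (colour c (r ?n) G v + 1) * (2 * nd_radius c (r ?n) ?n + r ?n) \<le> T ?n"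
        unfolding T_def sim_rounds_def by (intro add_left_mono mult_le_mono1)
      from agree_slocal_memory[OF same_view_mono[OF *(1,2,4) this], of A]
      show ?thesis
        using *(3) by (simp add: M_def)
    qed
    obtain B where B: "\<And>G x. network c G \<Longrightarrow> dom x = pverts G \<Longrightarrow>
        local_output B (T (card (pverts G))) G x =
        (\<lambda>v. if v \<in> pverts G then Some (s_out A (the (M G x v))) else None)"
      using local_alg_exists[of c T "\<lambda>G x v. s_out A (the (M G x v))"] local by blast
    have "local_solves c B T P"
      unfolding local_solves_def
    proof (intro allI impI)
      fix G and x :: labelling assume G: "network c G" "dom x = pverts G"
      let ?n = "card (pverts G)"
      let ?vs = "key_order (colour c (r ?n) G) (pverts G)"
      have "P G x (slocal_output A (r ?n) G x ?vs)"
        using A G key_order(1,2)[OF network_facts(1)[OF G(1)]] by (simp add: slocal_solves_def)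
      also have "slocal_output A (r ?n) G x ?vs = map_option (s_out A) \<circ> M G x"
        by (simp add: slocal_output_def M_def slocal_memory_def)
      also have "\<dots> = local_output B (T ?n) G x"
      proof -
        have dom: "dom (M G x) = pverts G"
          using dom_slocal_memory[OF G(1)] by (simp add: M_def)
        have "map_option (s_out A) (M G x v) =
            (if v \<in> pverts G then Some (s_out A (the (M G x v))) else None)" for v
        proof (cases "v \<in> pverts G")
          case True
          then obtain m where "M G x v = Some m"
            using dom by blast
          with True show ?thesis by simp
        next
          case False
          then have "M G x v = None"
            using dom by blast
          with False show ?thesis by simp
        qed
        then show ?thesis
          unfolding B[OF G] by (simp add: fun_eq_iff)
      qed
      finally show "P G x (local_output B (T ?n) G x)" .
    qed
    moreover have "polylog (\<lambda>n. real (T n))"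
      unfolding T_def using r by (rule polylog_sim_rounds)
    ultimately show "\<exists>A T. polylog (\<lambda>n. real (T n)) \<and> local_solves c A T P"
      by blast
  qed
qed

section \<open>Approximating dominating sets by ball growing\<close>

definition dominates :: "network \<Rightarrow> nat set \<Rightarrow> nat set \<Rightarrow> bool" where
  "dominates G D X \<longleftrightarrow> (\<forall>x\<in>X. x \<in> D \<or> (\<exists>w\<in>D. w \<in> nbrs G x))"

definition closed_nbrs :: "network \<Rightarrow> nat set \<Rightarrow> nat set" where
  "closed_nbrs G X = X \<union> (\<Union>x\<in>X. nbrs G x)"

text \<open>Candidates are confined to the closed neighbourhood of \<open>X\<close>, so the number
  is determined by the neighbourhoods of the nodes in \<open>X\<close>.\<close>

definition dom_num :: "network \<Rightarrow> nat set \<Rightarrow> nat" where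
  "dom_num G X = (LEAST k. \<exists>D. D \<subseteq> closed_nbrs G X \<and> dominates G D X \<and> card D = k)"

definition min_dom :: "network \<Rightarrow> nat set \<Rightarrow> nat set" where
  "min_dom G X = (SOME D. D \<subseteq> closed_nbrs G X \<and> dominates G D X \<and> card D = dom_num G X)"

lemma min_dom:
  "min_dom G X \<subseteq> closed_nbrs G X" "dominates G (min_dom G X) X" "card (min_dom G X) = dom_num G X"
proof -
  have "X \<subseteq> closed_nbrs G X \<and> dominates G X X \<and> card X = card X"
    by (auto simp: closed_nbrs_def dominates_def)
  then have "\<exists>D. D \<subseteq> closed_nbrs G X \<and> dominates G D X \<and> card D = dom_num G X"
    unfolding dom_num_def by - (rule LeastI_ex, blast)
  then have "min_dom G X \<subseteq> closed_nbrs G X \<and> dominates G (min_dom G X) X \<and> card (min_dom G X) = dom_num G X"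
    unfolding min_dom_def by (rule someI_ex)
  then show "min_dom G X \<subseteq> closed_nbrs G X" "dominates G (min_dom G X) X" "card (min_dom G X) = dom_num G X"
    by auto
qed

text \<open>Only members of \<open>S\<close> in the closed neighbourhood can dominate nodes of
  \<open>X\<close>. Counting just these lets lower bounds over disjoint neighbourhoods add
  up.\<close>

lemma dom_num_le:
  assumes "dominates G S X"
  shows "dom_num G X \<le> card (S \<inter> closed_nbrs G X)"
  unfolding dom_num_def
proof (intro Least_le exI conjI)
  show "dominates G (S \<inter> closed_nbrs G X) X"
    using assms unfolding dominates_def closed_nbrs_def by blast
qed auto

lemma dom_num_le_card: "dom_num G X \<le> card X"
  using dom_num_le[of G X X] by (simp add: dominates_def closed_nbrs_def Int_absorb2)

lemma dom_num_pos:
  assumes "network c G" "X \<subseteq> pverts G" "X \<noteq> {}"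
  shows "dom_num G X \<ge> 1"
proof -
  have "closed_nbrs G X \<subseteq> pverts G"
    using assms(2) nbrs_subset[OF assms(1)] by (auto simp: closed_nbrs_def)
  then have "finite (min_dom G X)"
    using min_dom(1)[of G X] network_facts(1)[OF assms(1)] by (meson finite_subset)
  moreover have "min_dom G X \<noteq> {}"
    using min_dom(2)[of G X] assms(3) by (auto simp: dominates_def)
  ultimately show ?thesis
    unfolding min_dom(3)[symmetric] by (simp add: Suc_le_eq card_gt_0_iff)
qed

lemma
  assumes "\<And>x. x \<in> X \<Longrightarrow> nbrs G x = nbrs H x"
  shows dom_num_cong: "dom_num G X = dom_num H X" and min_dom_cong: "min_dom G X = min_dom H X"
proof -
  have "closed_nbrs G X = closed_nbrs H X" "dominates G D X = dominates H D X" for D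
    using assms by (auto simp: closed_nbrs_def dominates_def)
  then show "dom_num G X = dom_num H X" "min_dom G X = min_dom H X"
    by (simp_all add: min_dom_def dom_num_def)
qed

section \<open>Growing a ball and recording the result in memory\<close>

definition growth :: "network \<Rightarrow> nat set \<Rightarrow> nat \<Rightarrow> nat \<Rightarrow> nat" where
  "growth G U v i = dom_num G (hop_ball G i v \<inter> U)"

text \<open>The disjunct \<open>i > 2 * J\<close> makes the radius visible in a bounded ball; it never fires.\<close>

definition stop_radius :: "real \<Rightarrow> nat \<Rightarrow> network \<Rightarrow> nat set \<Rightarrow> nat \<Rightarrow> nat" where
  "stop_radius \<epsilon> J G U v = (LEAST i. 1 \<le> i \<and>
     (real (growth G U v (i + 2)) \<le> (1 + \<epsilon>) * real (growth G U v i) \<or> i > 2 * J))"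

definition mem_removed :: "nat \<Rightarrow> nat set" where
  "mem_removed m = set_decode (fst (prod_decode (snd (prod_decode m))))"

definition mem_chosen :: "nat \<Rightarrow> nat set" where
  "mem_chosen m = set_decode (snd (prod_decode (snd (prod_decode m))))"

definition mem_out :: "nat \<Rightarrow> nat" where
  "mem_out m = fst (prod_decode m)"

definition mem_code :: "bool \<Rightarrow> nat set \<Rightarrow> nat set \<Rightarrow> nat" where
  "mem_code b X D = prod_encode (of_bool b, prod_encode (set_encode X, set_encode D))"

lemma mem_code [simp]:
  "mem_out (mem_code b X D) = of_bool b"
  "finite X \<Longrightarrow> mem_removed (mem_code b X D) = X"
  "finite D \<Longrightarrow> mem_chosen (mem_code b X D) = D"
  by (simp_all add: mem_out_def mem_removed_def mem_chosen_def mem_code_def)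

definition removed :: "labelling \<Rightarrow> nat set" where
  "removed M = (\<Union>u\<in>dom M. mem_removed (the (M u)))"

definition chosen :: "labelling \<Rightarrow> nat set" where
  "chosen M = (\<Union>u\<in>dom M. mem_chosen (the (M u)))"

text \<open>In the second case the 1-hop ball meets \<open>U\<close>, so growth starts from a
  positive domination number.\<close>

definition carve_ball :: "real \<Rightarrow> nat \<Rightarrow> network \<Rightarrow> nat set \<Rightarrow> nat \<Rightarrow> nat set" where
  "carve_ball \<epsilon> J G U v = (if hop_ball G 1 v \<inter> U = {} then {}
     else hop_ball G (stop_radius \<epsilon> J G U v + 2) v \<inter> U)"

definition mds_step :: "real \<Rightarrow> nat \<Rightarrow> network \<Rightarrow> labelling \<Rightarrow> nat \<Rightarrow> nat" where
  "mds_step \<epsilon> J G M v =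
     (let X = carve_ball \<epsilon> J G (pverts G - removed M) v; D = min_dom G X
      in mem_code (v \<in> chosen M \<union> D) X D)"

lemma min_dom_empty [simp]: "min_dom G {} = {}"
  using min_dom(1)[of G "{}"] by (simp add: closed_nbrs_def)

lemma stop_radius_le: "stop_radius \<epsilon> J G U v \<le> 2 * J + 1"
  unfolding stop_radius_def by (rule Least_le) simp

text \<open>Otherwise \<open>g\<close> would grow by the factor \<open>1 + \<epsilon>\<close> along
  the odd arguments, \<open>J\<close> times from a value of at least 1, and exceed
  \<open>n\<close>.\<close>

lemma ball_growing:
  fixes g :: "nat \<Rightarrow> nat"
  assumes "1 \<le> g 1" "\<And>i. g i \<le> n" "0 < \<epsilon>" "real n < (1 + \<epsilon>) ^ J"
  shows "\<exists>i\<ge>1. i \<le> 2 * J \<and> real (g (i + 2)) \<le> (1 + \<epsilon>) * real (g i)"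
proof (rule ccontr)
  assume "\<not> ?thesis"
  then have grow: "(1 + \<epsilon>) * real (g i) < real (g (i + 2))" if "1 \<le> i" "i \<le> 2 * J" for i
    using that by (meson not_le)
  have "(1 + \<epsilon>) ^ t \<le> real (g (2 * t + 1))" if "t \<le> J" for t
    using that
  proof (induction t)
    case (Suc t)
    then have "(1 + \<epsilon>) * (1 + \<epsilon>) ^ t \<le> (1 + \<epsilon>) * real (g (2 * t + 1))"
      using assms(3) by (intro mult_left_mono) auto
    also have "\<dots> < real (g (2 * t + 1 + 2))"
      using Suc.prems by (intro grow) auto
    finally show ?case by simp
  qed (use assms(1) in simp)
  from this[of J] assms(2)[of "2 * J + 1"] assms(4) show False
    by linarith
qed

lemma stop_radius:
  assumes "network c G" "U \<subseteq> pverts G" "hop_ball G 1 v \<inter> U \<noteq> {}" "0 < \<epsilon>"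
    "real (card (pverts G)) < (1 + \<epsilon>) ^ J"
  defines "i \<equiv> stop_radius \<epsilon> J G U v"
  shows "1 \<le> i" "real (growth G U v (i + 2)) \<le> (1 + \<epsilon>) * real (growth G U v i)"
proof -
  have "\<exists>i\<ge>1. i \<le> 2 * J \<and> real (growth G U v (i + 2)) \<le> (1 + \<epsilon>) * real (growth G U v i)"
  proof (rule ball_growing[where g = "growth G U v" and n = "card (pverts G)"])
    show "1 \<le> growth G U v 1"
      unfolding growth_def using assms(2,3) by (intro dom_num_pos[OF assms(1)]) auto
    fix i
    have "dom_num G (hop_ball G i v \<inter> U) \<le> card (hop_ball G i v \<inter> U)"
      by (rule dom_num_le_card)
    also have "\<dots> \<le> card (pverts G)"
      using assms(2) network_facts(1)[OF assms(1)] by (intro card_mono) auto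
    finally show "growth G U v i \<le> card (pverts G)"
      by (simp add: growth_def)
  qed (fact assms(4) assms(5))+
  then obtain i0 where i0: "1 \<le> i0" "i0 \<le> 2 * J"
    "real (growth G U v (i0 + 2)) \<le> (1 + \<epsilon>) * real (growth G U v i0)"
    by blast
  then have "1 \<le> i \<and> (real (growth G U v (i + 2)) \<le> (1 + \<epsilon>) * real (growth G U v i) \<or> i > 2 * J)"
    unfolding i_def stop_radius_def
    by (intro LeastI[where P = "\<lambda>i. 1 \<le> i \<and> (real (growth G U v (i + 2)) \<le> (1 + \<epsilon>) * real (growth G U v i) \<or> i > 2 * J)" and k = i0]) simp
  \<comment> \<open>The minimum is at most \<open>2 * J\<close>, so the cutoff disjunct is false
    there and the growth condition holds.\<close>
  moreover have "i \<le> i0"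
    unfolding i_def stop_radius_def using i0
    by (intro Least_le[where P = "\<lambda>i. 1 \<le> i \<and> (real (growth G U v (i + 2)) \<le> (1 + \<epsilon>) * real (growth G U v i) \<or> i > 2 * J)" and k = i0]) simp
  ultimately show "1 \<le> i" "real (growth G U v (i + 2)) \<le> (1 + \<epsilon>) * real (growth G U v i)"
    using i0 by simp_all
qed

section \<open>The view suffices to carry out a step\<close>

lemma hop_ball_induced:
  assumes "network c G" "i \<le> r" "v \<in> pverts G"
  shows "hop_ball (induced G (hop_ball G r v)) i v = hop_ball G i v"
proof -
  let ?B = "hop_ball G r v"
  \<comment> \<open>Every prefix of a path of length at most \<open>r\<close> from the centre ends
    in the ball, so the path survives in the induced subgraph.\<close>
  have 1: "(v, u) \<in> parcs (induced G ?B) ^^ k" if "(v, u) \<in> parcs G ^^ k" "k \<le> r" for u k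
    using that
  proof (induction k arbitrary: u)
    case (Suc k)
    then obtain w where w: "(v, w) \<in> parcs G ^^ k" "(w, u) \<in> parcs G"
      by auto
    have "w \<in> pverts G" "u \<in> pverts G" "k \<le> r"
      using w(2) Suc.prems(2) network_facts(2,3)[OF assms(1)] by auto
    then have "w \<in> ?B" "u \<in> ?B"
      using w(1) Suc.prems unfolding hop_ball_def by blast+
    then have "(w, u) \<in> parcs (induced G ?B)"
      using w(2) by (simp add: induced_def)
    then show ?case
      using Suc.IH[OF w(1)] Suc.prems by auto
  qed simp
  have "parcs (induced G ?B) ^^ k \<subseteq> parcs G ^^ k" for k
    by (induction k) (auto simp: induced_def)
  then have 2: "(v, u) \<in> parcs G ^^ k" if "(v, u) \<in> parcs (induced G ?B) ^^ k" for u k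
    using that by blast
  show ?thesis
  proof
    show "hop_ball (induced G ?B) i v \<subseteq> hop_ball G i v"
    proof
      fix u assume "u \<in> hop_ball (induced G ?B) i v"
      then obtain k where "k \<le> i" "(v, u) \<in> parcs (induced G ?B) ^^ k" "u \<in> pverts (induced G ?B)"
        unfolding hop_ball_def by blast
      then have "k \<le> i" "(v, u) \<in> parcs G ^^ k" "u \<in> pverts G"
        using 2 by (auto simp: induced_def)
      then show "u \<in> hop_ball G i v"
        unfolding hop_ball_def by blast
    qed
    show "hop_ball G i v \<subseteq> hop_ball (induced G ?B) i v"
    proof
      fix u assume u: "u \<in> hop_ball G i v"
      then obtain k where k: "k \<le> i" "(v, u) \<in> parcs G ^^ k" "u \<in> pverts G"
        unfolding hop_ball_def by blast
      have "u \<in> pverts (induced G ?B)"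
        using u k(3) hop_ball_mono[OF assms(2), of G v] by (auto simp: induced_def)
      moreover have "(v, u) \<in> parcs (induced G ?B) ^^ k"
        using 1[OF k(2)] k(1) assms(2) by linarith
      ultimately show "u \<in> hop_ball (induced G ?B) i v"
        using k(1) unfolding hop_ball_def by blast
    qed
  qed
qed

lemma nbrs_induced:
  assumes "network c G" "u \<in> hop_ball G s v" "s < r"
  shows "nbrs (induced G (hop_ball G r v)) u = nbrs G u"
proof -
  have "u \<in> hop_ball G r v"
    using assms hop_ball_mono[of s r] by auto
  moreover have "w \<in> hop_ball G r v" if "w \<in> nbrs G u" for w
    using hop_ball_add[OF assms(2) nbrs_hop_ball[OF assms(1) that]] hop_ball_mono[of "s + 1" r] assms(3)
    by auto
  ultimately show ?thesis
    by (auto simp: nbrs_def induced_def)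
qed

text \<open>The stopping radius is at most \<open>2 * J + 1\<close>; the outer ball adds 2 hops, and
  its dominating set one more.\<close>

definition localized :: "nat \<Rightarrow> network \<Rightarrow> labelling \<Rightarrow> bool" where
  "localized J G M \<longleftrightarrow> (\<forall>u\<in>dom M. mem_removed (the (M u)) \<subseteq> hop_ball G (2 * J + 3) u \<and>
     mem_chosen (the (M u)) \<subseteq> hop_ball G (2 * J + 4) u)"

text \<open>The step inspects nodes up to \<open>2 * J + 3\<close> hops away, and whoever removed
  such a node is at most \<open>2 * J + 3\<close> hops further, hence the radius
  \<open>4 * J + 6\<close>.\<close>

lemma mds_step_view:
  assumes net: "network c G" and v: "v \<in> pverts G" and loc: "localized J G M"
  shows "mds_step \<epsilon> J (induced G (hop_ball G (4 * J + 6) v)) (M |` hop_ball G (4 * J + 6) v) v =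
    mds_step \<epsilon> J G M v"
proof -
  let ?r = "4 * J + 6"
  let ?B = "hop_ball G ?r v"
  let ?H = "induced G ?B"
  let ?U = "pverts G - removed M" and ?U' = "pverts ?H - removed (M |` ?B)"
  have ball: "hop_ball ?H i v = hop_ball G i v" if "i \<le> 2 * J + 3" for i
    using that by (intro hop_ball_induced[OF net _ v]) simp
  have X: "hop_ball ?H i v \<inter> ?U' = hop_ball G i v \<inter> ?U" if i: "i \<le> 2 * J + 3" for i
  proof -
    have "w \<in> ?U' \<longleftrightarrow> w \<in> ?U" if w: "w \<in> hop_ball G i v" for w
    proof -
      have "w \<in> ?B"
        using w i hop_ball_mono[of i ?r] by auto
      moreover have "u \<in> ?B" if "u \<in> dom M" "w \<in> mem_removed (the (M u))" for u
      proof -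
        have "u \<in> hop_ball G (2 * J + 3) w"
          using that loc hop_ball_sym[OF net] unfolding localized_def by blast
        from hop_ball_add[OF w this] show ?thesis
          using i hop_ball_mono[of "i + (2 * J + 3)" ?r] by auto
      qed
      ultimately show ?thesis
        by (auto simp: removed_def induced_def)
    qed
    then show ?thesis
      unfolding ball[OF i] by blast
  qed
  have nb: "nbrs ?H u = nbrs G u" if "u \<in> hop_ball G i v" "i \<le> 2 * J + 3" for u i
    using that by (intro nbrs_induced[OF net]) auto
  have growth: "growth ?H ?U' v i = growth G ?U v i" if "i \<le> 2 * J + 3" for i
    unfolding growth_def X[OF that] using nb[OF _ that] by (intro dom_num_cong) auto
  have "stop_radius \<epsilon> J ?H ?U' v = stop_radius \<epsilon> J G ?U v"
    unfolding stop_radius_def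
  proof (rule arg_cong[where f = Least], rule ext)
    fix i
    show "(1 \<le> i \<and> (real (growth ?H ?U' v (i + 2)) \<le> (1 + \<epsilon>) * real (growth ?H ?U' v i) \<or> i > 2 * J)) =
      (1 \<le> i \<and> (real (growth G ?U v (i + 2)) \<le> (1 + \<epsilon>) * real (growth G ?U v i) \<or> i > 2 * J))"
    \<comment> \<open>Beyond \<open>2 * J\<close> the cutoff makes both sides true, so growth is
      only compared inside the view.\<close>
    proof (cases "i \<le> 2 * J")
      case True
      then show ?thesis using growth[of i] growth[of "i + 2"] by simp
    qed simp
  qed
  then have c: "carve_ball \<epsilon> J ?H ?U' v = carve_ball \<epsilon> J G ?U v"
    using X[of 1] X[of "stop_radius \<epsilon> J G ?U v + 2"] stop_radius_le[of \<epsilon> J G ?U v]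
    by (simp add: carve_ball_def)
  have "carve_ball \<epsilon> J G ?U v \<subseteq> hop_ball G (stop_radius \<epsilon> J G ?U v + 2) v"
    by (auto simp: carve_ball_def)
  then have m: "min_dom ?H (carve_ball \<epsilon> J G ?U v) = min_dom G (carve_ball \<epsilon> J G ?U v)"
    using stop_radius_le[of \<epsilon> J G ?U v] nb[of _ "stop_radius \<epsilon> J G ?U v + 2"]
    by (intro min_dom_cong) auto
  have "u \<in> ?B" if "u \<in> dom M" "v \<in> mem_chosen (the (M u))" for u
  proof -
    have "u \<in> hop_ball G (2 * J + 4) v"
      using that loc hop_ball_sym[OF net] unfolding localized_def by blast
    then show ?thesis
      using hop_ball_mono[of "2 * J + 4" ?r] by auto
  qed
  then have "v \<in> chosen (M |` ?B) \<longleftrightarrow> v \<in> chosen M"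
    by (auto simp: chosen_def)
  with c m show ?thesis
    by (simp add: mds_step_def Let_def)
qed

text \<open>\<open>W\<close> collects the inner balls. As everything within two hops of
  \<open>W\<close> is removed, later inner balls have closed neighbourhoods disjoint from that of
  \<open>W\<close>, and the share of any dominating set \<open>S\<close> there pays for the chosen
  nodes.\<close>

definition mds_invariant :: "real \<Rightarrow> nat \<Rightarrow> network \<Rightarrow> labelling \<Rightarrow> bool" where
  "mds_invariant \<epsilon> J G M \<longleftrightarrow> localized J G M \<and> dominates G (chosen M) (removed M) \<and>
     removed M \<subseteq> pverts G \<and> chosen M \<subseteq> pverts G \<and>
     (\<forall>u\<in>dom M. hop_ball G 1 u \<subseteq> removed M \<and> (mem_out (the (M u)) = 1 \<longleftrightarrow> u \<in> chosen M)) \<and>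
     (\<exists>W. W \<subseteq> pverts G \<and> (\<forall>w\<in>W. hop_ball G 2 w \<subseteq> removed M) \<and>
        (\<forall>S. dominating_set G S \<longrightarrow> real (card (chosen M)) \<le> (1 + \<epsilon>) * real (card (S \<inter> closed_nbrs G W))))"

lemma closed_nbrs_hop_ball:
  assumes "network c G" "X \<subseteq> pverts G" "u \<in> closed_nbrs G X"
  shows "\<exists>x\<in>X. u \<in> hop_ball G 1 x"
proof -
  obtain x where x: "x \<in> X" "u = x \<or> u \<in> nbrs G x"
    using assms(3) unfolding closed_nbrs_def by blast
  then have "u \<in> hop_ball G 1 x"
    using hop_ball_center nbrs_hop_ball[OF assms(1)] assms(2) by blast
  with x(1) show ?thesis ..
qed

lemma mds_invariant_step:
  assumes net: "network c G" and inv: "mds_invariant \<epsilon> J G M" and v: "v \<in> pverts G" "v \<notin> dom M"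
    and \<epsilon>: "0 < \<epsilon>" "real (card (pverts G)) < (1 + \<epsilon>) ^ J"
  shows "mds_invariant \<epsilon> J G (M(v \<mapsto> mds_step \<epsilon> J G M v))"
proof -
  let ?U = "pverts G - removed M"
  define X where "X = carve_ball \<epsilon> J G ?U v"
  define D where "D = min_dom G X"
  define M' where "M' = M(v \<mapsto> mds_step \<epsilon> J G M v)"
  let ?i = "stop_radius \<epsilon> J G ?U v"
  have step: "mds_step \<epsilon> J G M v = mem_code (v \<in> chosen M \<union> D) X D"
    by (simp add: mds_step_def Let_def X_def D_def)
  have X_sub: "X \<subseteq> ?U" "X \<subseteq> hop_ball G (2 * J + 3) v"
    using hop_ball_mono[of "?i + 2" "2 * J + 3" G v] stop_radius_le[of \<epsilon> J G ?U v]
    by (auto simp: X_def carve_ball_def)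
  have D_near: "\<exists>x\<in>X. u \<in> hop_ball G 1 x" if "u \<in> D" for u
    using that min_dom(1)[of G X] X_sub(1) unfolding D_def by (intro closed_nbrs_hop_ball[OF net]) auto
  have D_sub: "D \<subseteq> hop_ball G (2 * J + 4) v"
  proof
    fix u assume "u \<in> D"
    then obtain x where "x \<in> X" and u: "u \<in> hop_ball G 1 x"
      using D_near by blast
    then have "x \<in> hop_ball G (2 * J + 3) v"
      using X_sub(2) by blast
    then have "u \<in> hop_ball G (2 * J + 3 + 1) v"
      using u by (rule hop_ball_add)
    then show "u \<in> hop_ball G (2 * J + 4) v"
      by (simp add: numeral_eq_Suc)
  qed
  have fin: "finite X" "finite D"
    using finite_subset[OF X_sub(2)] finite_subset[OF D_sub] net by auto
  have removed: "removed M' = removed M \<union> X" and chosen: "chosen M' = chosen M \<union> D"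
  proof -
    have "dom M' = insert v (dom M)" "\<And>u. u \<in> dom M \<Longrightarrow> M' u = M u" "M' v = Some (mem_code (v \<in> chosen M \<union> D) X D)"
      using v(2) by (auto simp: M'_def step)
    then show "removed M' = removed M \<union> X" "chosen M' = chosen M \<union> D"
      using fin by (simp_all add: removed_def chosen_def Un_commute)
  qed
  \<comment> \<open>A newly chosen node is within one hop of \<open>X\<close>, but the 1-hop ball of
    a processed node has already been removed. So earlier outputs stay correct.\<close>
  have D_old: "u \<notin> D" if "u \<in> dom M" for u
  proof
    assume "u \<in> D"
    then obtain x where "x \<in> X" "u \<in> hop_ball G 1 x"
      using D_near by blast
    then have "x \<in> hop_ball G 1 u"
      using hop_ball_sym[OF net] by blast
    then have "x \<in> removed M"
      using inv that unfolding mds_invariant_def by blast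
    with \<open>x \<in> X\<close> X_sub(1) show False by blast
  qed
  have v_done: "hop_ball G 1 v \<subseteq> removed M'"
  proof (cases "hop_ball G 1 v \<inter> ?U = {}")
    case False
    then have "hop_ball G 1 v \<inter> ?U \<subseteq> X"
      using hop_ball_mono[of 1 "?i + 2" G v] by (auto simp: X_def carve_ball_def)
    then show ?thesis
      using hop_ball_subset[of G 1 v] unfolding removed by blast
  qed (use hop_ball_subset[of G 1 v] removed in blast)
  have "\<exists>W. W \<subseteq> pverts G \<and> (\<forall>w\<in>W. hop_ball G 2 w \<subseteq> removed M') \<and>
      (\<forall>S. dominating_set G S \<longrightarrow> real (card (chosen M')) \<le> (1 + \<epsilon>) * real (card (S \<inter> closed_nbrs G W)))"
  proof -
    obtain W where W: "W \<subseteq> pverts G" "\<And>w. w \<in> W \<Longrightarrow> hop_ball G 2 w \<subseteq> removed M"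
      "\<And>S. dominating_set G S \<Longrightarrow> real (card (chosen M)) \<le> (1 + \<epsilon>) * real (card (S \<inter> closed_nbrs G W))"
      using inv unfolding mds_invariant_def by blast
    show ?thesis
    proof (cases "hop_ball G 1 v \<inter> ?U = {}")
      case True
      then have "X = {}" "D = {}"
        by (simp_all add: X_def D_def carve_ball_def)
      then show ?thesis
        unfolding removed chosen using W by auto
    next
      case False
      define Y where "Y = hop_ball G ?i v \<inter> ?U"
      have X_eq: "X = hop_ball G (?i + 2) v \<inter> ?U"
        using False by (simp add: X_def carve_ball_def)
      \<comment> \<open>The cost is the domination number of the outer part; the stopping rule
        compares it with the inner part \<open>Y\<close>.\<close>
      have dX: "real (card D) \<le> (1 + \<epsilon>) * real (dom_num G Y)"
        using stop_radius(2)[OF net _ False \<epsilon>] unfolding D_def min_dom(3) X_eq Y_def growth_def by blast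
      have Y2: "hop_ball G 2 y \<subseteq> removed M'" if "y \<in> Y" for y
        using that hop_ball_add[of y G ?i v _ 2] hop_ball_subset[of G 2 y]
        unfolding removed X_eq Y_def by blast
      \<comment> \<open>A common point would put some \<open>y\<close> in \<open>Y\<close> within
        two hops of \<open>W\<close>, hence among the nodes removed earlier.\<close>
      have disj: "closed_nbrs G W \<inter> closed_nbrs G Y = {}"
      proof (rule equals0I)
        fix z assume "z \<in> closed_nbrs G W \<inter> closed_nbrs G Y"
        then obtain w y where wy: "w \<in> W" "z \<in> hop_ball G 1 w" "y \<in> Y" "z \<in> hop_ball G 1 y"
          using closed_nbrs_hop_ball[OF net W(1)] closed_nbrs_hop_ball[OF net, of Y] unfolding Y_def by blast
        have "y \<in> hop_ball G (1 + 1) w"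
          using wy(2) hop_ball_sym[OF net wy(4)] by (rule hop_ball_add)
        then have "y \<in> removed M"
          using W(2)[OF wy(1)] by (auto simp: numeral_2_eq_2)
        with wy(3) show False by (simp add: Y_def)
      qed
      have "real (card (chosen M')) \<le> (1 + \<epsilon>) * real (card (S \<inter> closed_nbrs G (W \<union> Y)))"
        if S: "dominating_set G S" for S
      proof -
        have finS: "finite S"
          using S network_facts(1)[OF net] by (auto simp: dominating_set_def intro: finite_subset)
        have "dominates G S Y"
          using S by (auto simp: dominating_set_def dominates_def Y_def nbrs_def)
        then have "dom_num G Y \<le> card (S \<inter> closed_nbrs G Y)"
          by (rule dom_num_le)
        then have "(1 + \<epsilon>) * real (dom_num G Y) \<le> (1 + \<epsilon>) * real (card (S \<inter> closed_nbrs G Y))"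
          using \<epsilon>(1) by (intro mult_left_mono) auto
        with dX have D: "real (card D) \<le> (1 + \<epsilon>) * real (card (S \<inter> closed_nbrs G Y))"
          by linarith
        have "card (S \<inter> closed_nbrs G (W \<union> Y)) = card ((S \<inter> closed_nbrs G W) \<union> (S \<inter> closed_nbrs G Y))"
          by (rule arg_cong[where f = card]) (auto simp: closed_nbrs_def)
        also have "\<dots> = card (S \<inter> closed_nbrs G W) + card (S \<inter> closed_nbrs G Y)"
          using finS disj by (intro card_Un_disjoint) auto
        finally have "(1 + \<epsilon>) * real (card (S \<inter> closed_nbrs G (W \<union> Y))) =
            (1 + \<epsilon>) * real (card (S \<inter> closed_nbrs G W)) + (1 + \<epsilon>) * real (card (S \<inter> closed_nbrs G Y))"
          by (simp add: distrib_left)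
        moreover have "real (card (chosen M')) \<le> real (card (chosen M)) + real (card D)"
          unfolding chosen using card_Un_le[of "chosen M" D] by linarith
        ultimately show ?thesis
          using W(3)[OF S] D by linarith
      qed
      moreover have "hop_ball G 2 w \<subseteq> removed M'" if "w \<in> W \<union> Y" for w
        using that W(2) Y2 unfolding removed by blast
      moreover have "W \<union> Y \<subseteq> pverts G"
        using W(1) by (auto simp: Y_def)
      ultimately show ?thesis by blast
    qed
  qed
  moreover have "localized J G M'"
    using inv X_sub(2) D_sub fin by (auto simp: mds_invariant_def localized_def M'_def step)
  moreover have "dominates G (chosen M') (removed M')"
    using inv min_dom(2)[of G X] unfolding removed chosen D_def[symmetric]
    by (auto simp: mds_invariant_def dominates_def)
  moreover have "removed M' \<subseteq> pverts G" "chosen M' \<subseteq> pverts G"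
    using inv X_sub(1) D_sub hop_ball_subset[of G "2 * J + 4" v] unfolding removed chosen mds_invariant_def by blast+
  moreover have "hop_ball G 1 u \<subseteq> removed M' \<and> (mem_out (the (M' u)) = 1 \<longleftrightarrow> u \<in> chosen M')"
    if "u \<in> dom M'" for u
  proof (cases "u = v")
    case True
    then show ?thesis
      using v_done by (simp add: M'_def[symmetric] chosen) (simp add: M'_def step)
  next
    case False
    then have "u \<in> dom M" "M' u = M u"
      using that by (auto simp: M'_def)
    then show ?thesis
      using inv D_old unfolding mds_invariant_def removed chosen by auto
  qed
  ultimately show ?thesis
    unfolding M'_def[symmetric] by (simp add: mds_invariant_def)
qed

section \<open>Correctness of the sequential algorithm\<close>

definition mds_alg :: "real \<Rightarrow> (nat \<Rightarrow> nat) \<Rightarrow> slocal_alg" where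
  "mds_alg \<epsilon> J = \<lparr> s_process = (\<lambda>w. mds_step \<epsilon> (J (sv_size w)) (sv_graph w) (sv_memory w) (sv_center w)),
     s_out = mem_out \<rparr>"

text \<open>The invariant contains \<open>localized\<close>, which allows the view to replace the
  whole network at each step.\<close>

lemma mds_invariant_foldl:
  assumes net: "network c G" and inv: "mds_invariant \<epsilon> (J (card (pverts G))) G M"
    and vs: "distinct vs" "set vs \<subseteq> pverts G" "set vs \<inter> dom M = {}"
    and \<epsilon>: "0 < \<epsilon>" "real (card (pverts G)) < (1 + \<epsilon>) ^ J (card (pverts G))"
  shows "mds_invariant \<epsilon> (J (card (pverts G))) G
    (foldl (\<lambda>M v. M(v \<mapsto> s_process (mds_alg \<epsilon> J) (slocal_view_of (4 * J (card (pverts G)) + 6) G x M v))) M vs)"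
  using inv vs
proof (induction vs arbitrary: M)
  case (Cons v vs)
  let ?J = "J (card (pverts G))"
  have step: "s_process (mds_alg \<epsilon> J) (slocal_view_of (4 * ?J + 6) G x M v) = mds_step \<epsilon> ?J G M v"
    using mds_step_view[OF net, of v ?J M \<epsilon>] Cons.prems
    by (simp add: mds_alg_def slocal_view_of_def mds_invariant_def)
  have inv: "mds_invariant \<epsilon> ?J G (M(v \<mapsto> mds_step \<epsilon> ?J G M v))"
    using Cons.prems by (intro mds_invariant_step[OF net _ _ _ \<epsilon>]) auto
  have disj: "set vs \<inter> dom (M(v \<mapsto> mds_step \<epsilon> ?J G M v)) = {}"
    using Cons.prems by auto
  have "distinct vs" "set vs \<subseteq> pverts G"
    using Cons.prems by auto
  from Cons.IH[OF inv this disj] show ?case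
    unfolding foldl.simps step .
qed simp

lemma mds_invariant_empty: "mds_invariant \<epsilon> J G Map.empty"
  by (auto simp: mds_invariant_def localized_def dominates_def removed_def chosen_def
      closed_nbrs_def intro!: exI[of _ "{}"])

lemma domination_number:
  assumes "network c G"
  shows "\<exists>S. dominating_set G S \<and> card S = domination_number G"
proof -
  have "dominating_set G (pverts G)"
    by (simp add: dominating_set_def)
  then show ?thesis
    unfolding domination_number_def by - (rule LeastI_ex, blast)
qed

text \<open>In the end every node lies in its own removed ball, so the chosen set dominates the
  network; the invariant is then applied to an optimal \<open>S\<close>.\<close>

lemma mds_alg_solves:
  assumes \<epsilon>: "0 < \<epsilon>" "\<And>n. real n < (1 + \<epsilon>) ^ J n" and \<alpha>: "\<And>n. n \<ge> 1 \<Longrightarrow> 1 + \<epsilon> \<le> \<alpha> n"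
  shows "slocal_solves c (mds_alg \<epsilon> J) (\<lambda>n. 4 * J n + 6) (mds_approx \<alpha>)"
  unfolding slocal_solves_def
proof (intro allI impI)
  fix G and x :: labelling and vs :: "nat list"
  assume net: "network c G" and vs: "distinct vs" "set vs = pverts G"
  let ?n = "card (pverts G)"
  define M where "M = foldl (\<lambda>M v. M(v \<mapsto> s_process (mds_alg \<epsilon> J)
    (slocal_view_of (4 * J ?n + 6) G x M v))) Map.empty vs"
  have dom: "dom M = pverts G"
    by (simp add: M_def dom_foldl_upd vs)
  have inv: "mds_invariant \<epsilon> (J ?n) G M"
    unfolding M_def
    using vs \<epsilon>(1) \<epsilon>(2)[of ?n]
    by (intro mds_invariant_foldl[where J = J, OF net mds_invariant_empty]) simp_all
  have "s_out (mds_alg \<epsilon> J) = mem_out"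
    by (simp add: mds_alg_def)
  then have out: "slocal_output (mds_alg \<epsilon> J) (4 * J ?n + 6) G x vs = map_option mem_out \<circ> M"
    by (simp add: slocal_output_def M_def)
  have D: "{v. (map_option mem_out \<circ> M) v = Some 1} = chosen M"
  proof -
    have "(map_option mem_out \<circ> M) v = Some 1 \<longleftrightarrow> v \<in> dom M \<and> mem_out (the (M v)) = 1" for v
      by (cases "M v") auto
    moreover have "chosen M \<subseteq> dom M" "\<forall>v\<in>dom M. mem_out (the (M v)) = 1 \<longleftrightarrow> v \<in> chosen M"
      using inv dom unfolding mds_invariant_def by blast+
    ultimately show ?thesis
      by blast
  qed
  have "hop_ball G 1 v \<subseteq> removed M" if "v \<in> pverts G" for v
    using inv dom that unfolding mds_invariant_def by blast
  then have sub: "pverts G \<subseteq> removed M"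
    using hop_ball_center by blast
  have dominating: "dominating_set G (chosen M)"
    unfolding dominating_set_def
  proof (intro conjI ballI)
    show "chosen M \<subseteq> pverts G"
      using inv by (simp add: mds_invariant_def)
    fix u assume "u \<in> pverts G"
    then have "u \<in> removed M"
      using sub by blast
    moreover have "dominates G (chosen M) (removed M)"
      using inv by (simp add: mds_invariant_def)
    ultimately show "u \<in> chosen M \<or> (\<exists>w\<in>chosen M. (u, w) \<in> parcs G)"
      by (auto simp: dominates_def nbrs_def)
  qed
  have card: "real (card (chosen M)) \<le> \<alpha> ?n * real (domination_number G)"
  \<comment> \<open>Nothing is assumed about \<open>\<alpha> 0\<close>; on the empty network both
    cardinalities vanish.\<close>
  proof (cases "?n = 0")
    case True
    then have "chosen M = {}"
      using network_facts(1)[OF net] dominating by (simp add: dominating_set_def)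
    moreover obtain S where "dominating_set G S" "card S = domination_number G"
      using domination_number[OF net] by blast
    then have "domination_number G = 0"
      using True network_facts(1)[OF net] by (simp add: dominating_set_def)
    ultimately show ?thesis by simp
  next
    case False
    obtain S where S: "dominating_set G S" "card S = domination_number G"
      using domination_number[OF net] by blast
    obtain W where "real (card (chosen M)) \<le> (1 + \<epsilon>) * real (card (S \<inter> closed_nbrs G W))"
      using inv S(1) unfolding mds_invariant_def by blast
    also have "\<dots> \<le> (1 + \<epsilon>) * real (card S)"
    proof (intro mult_left_mono of_nat_mono card_mono)
      show "finite S"
        using S(1) network_facts(1)[OF net] unfolding dominating_set_def by (meson finite_subset)
    qed (use \<epsilon>(1) in simp_all)
    also have "\<dots> \<le> \<alpha> ?n * real (domination_number G)"
      unfolding S(2) using \<alpha>[of ?n] False by (intro mult_right_mono) auto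
    finally show ?thesis .
  qed
  show "mds_approx \<alpha> G x (slocal_output (mds_alg \<epsilon> J) (4 * J ?n + 6) G x vs)"
    unfolding mds_approx_def out D Let_def using dominating card by blast
qed

lemma mds_approx_in_P_SLOCAL:
  assumes "0 < \<epsilon>" "\<And>n. n \<ge> 1 \<Longrightarrow> 1 + \<epsilon> \<le> \<alpha> n"
  shows "mds_approx \<alpha> \<in> P_SLOCAL"
proof -
  \<comment> \<open>As \<open>m\<close> growth factors exceed 2, the choice
    \<open>J = m * lg n\<close> makes \<open>(1 + \<epsilon>) ^ J\<close> exceed
    \<open>n\<close>.\<close>
  obtain m where m: "2 < (1 + \<epsilon>) ^ m"
    using real_arch_pow[of "1 + \<epsilon>" 2] assms(1) by auto
  have J: "real n < (1 + \<epsilon>) ^ (m * lg n)" for n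
  proof -
    have "real n < 2 ^ lg n"
      using less_two_power_lg[of n] by (metis of_nat_less_iff of_nat_numeral of_nat_power)
    also have "\<dots> \<le> ((1 + \<epsilon>) ^ m) ^ lg n"
      using m by (intro power_mono) auto
    finally show ?thesis by (simp add: power_mult)
  qed
  have "polylog (\<lambda>n. real (4 * (m * lg n) + 6))"
    unfolding of_nat_add of_nat_mult of_nat_numeral by (intro polylog_intros)
  moreover have "slocal_solves c (mds_alg \<epsilon> (\<lambda>n. m * lg n)) (\<lambda>n. 4 * (m * lg n) + 6) (mds_approx \<alpha>)" for c
    by (rule mds_alg_solves[where \<alpha> = \<alpha>, OF assms(1) J assms(2)])
  ultimately show ?thesis
    unfolding P_SLOCAL_def by (intro CollectI allI exI conjI)
qed

text \<open>Hardness comes from the inclusion of \<open>P_SLOCAL\<close> in \<open>P_LOCAL\<close>.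
  A fixed margin \<open>\<epsilon>\<close> above 1 keeps the ball-growing radius logarithmic, which
  gives membership.\<close>

theorem theorem7p6:
  fixes \<alpha> :: "nat \<Rightarrow> real"
  assumes "polylog \<alpha>"
  shows "P_SLOCAL_hard (mds_approx \<alpha>) \<and>
    ((\<exists>\<epsilon>>0. \<forall>n\<ge>1. 1 + \<epsilon> \<le> \<alpha> n) \<longrightarrow> P_SLOCAL_complete (mds_approx \<alpha>))"
  using P_SLOCAL_subset_P_LOCAL mds_approx_in_P_SLOCAL
  unfolding P_SLOCAL_complete_def P_SLOCAL_hard_def by blast

end
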